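(* (Fundamental theorem of loop symmetric functions.) The loop elementary symmetric functions $e_k^{(r)}$ ($k \in [m]$, $r \in [n]$) generate the ring ${\rm Inv}_R \cap \mathbb{C}[x_i^j]$ of polynomial invariants of the geometric $R$-matrices $R_1,\dots,R_{m-1}$.
   Context: Let $x_i^j$, $i \in [m]$, $j \in [n]$, be indeterminates, reindexed as $x_i^{(r)}$ with superscript $r$ taken modulo $n$ via $x_i^j = x_i^{(j+i-1)}$, so row $i$ is $\mathbf{x}_i = (x_i^{(i)}, x_i^{(i+1)},\dots,x_i^{(i+n-1)})$. For $k \in [m]$ and $r \in [n]$, the loop elementary symmetric function is $e_k^{(r)} = \sum_{1 \le i_1 < i_2 < \cdots < i_k \le m} x_{i_1}^{(r)} x_{i_2}^{(r+1)} \cdots x_{i_k}^{(r+k-1)}$. The geometric $R$-matrix is the rational map $R\bigl((x_1,\dots,x_n),(y_1,\dots,y_n)\bigr) = \bigl((y'_1,\dots,y'_n),(x'_1,\dots,x'_n)\bigr)$ with $y'_j = y_j \kappa_{j+1}/\kappa_j$, $x'_j = x_j \kappa_j/\kappa_{j+1}$, $\kappa_r = \sum_{k=0}^{n-1} y_r\cdots y_{r+k-1} x_{r+k+1}\cdots x_{r+n-1}$ (subscripts mod $n$). For $i \in [m-1]$, $R_i$ replaces the pair of rows $(\mathbf{x}_i,\mathbf{x}_{i+1})$ of the $m \times n$ matrix $(x_i^j)$ (rows $\mathbf{x}_i = (x_i^1,\dots,x_i^n)$) by $(\mathbf{x}'_{i+1},\mathbf{x}'_i) = R(\mathbf{x}_i,\mathbf{x}_{i+1})$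 and fixes the other rows. ${\rm Inv}_R \subset \mathbb{C}(x_i^j)$ is the field of rational functions fixed by all $R_i$. *)

theory Defs
  imports Complex_Main "HOL-Library.FuncSet"
begin

text \<open>Polynomial functions (with complex coefficients) in the variables indexed by V:
  the smallest set containing constants and coordinate functions for v in V, closed
  under sums and products.  Over the infinite field C this is the polynomial ring C[V].\<close>
inductive_set pfun :: "'v set \<Rightarrow> (('v \<Rightarrow> complex) \<Rightarrow> complex) set" for V :: "'v set" where
  pconst: "(\<lambda>X. c) \<in> pfun V"
| pvar: "v \<in> V \<Longrightarrow> (\<lambda>X. X v) \<in> pfun V"
| padd: "f \<in> pfun V \<Longrightarrow> g \<in> pfun V \<Longrightarrow> (\<lambda>X. f X + g X) \<in> pfun V"
| pmult: "f \<in> pfun V \<Longrightarrow> g \<in> pfun V \<Longrightarrow> (\<lambda>X. f X * g X) \<in> pfun V"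

text \<open>Matrices: X (i,j) = x_i^j, with 1 \<le> i \<le> m, 1 \<le> j \<le> n.\<close>

definition idx :: "nat \<Rightarrow> int \<Rightarrow> nat" where
  "idx n j = nat ((j - 1) mod int n) + 1"

text \<open>x_i^(r), where x_i^j = x_i^(j+i-1), superscript mod n; i.e. x_i^(r) = x_i^j with j = r - i + 1 mod n.\<close>
definition xr :: "nat \<Rightarrow> (nat \<times> nat \<Rightarrow> complex) \<Rightarrow> nat \<Rightarrow> nat \<Rightarrow> complex" where
  "xr n X i r = X (i, idx n (int r - int i + 1))"

definition loop_e :: "nat \<Rightarrow> nat \<Rightarrow> nat \<Rightarrow> nat \<Rightarrow> (nat \<times> nat \<Rightarrow> complex) \<Rightarrow> complex" where
  "loop_e m n k r X =
     (\<Sum>s \<in> {s \<in> {1..k} \<rightarrow>\<^sub>E {1..m}. strict_mono_on {1..k} s}.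
        \<Prod>t\<in>{1..k}. xr n X (s t) (r + t - 1))"

definition kappa :: "nat \<Rightarrow> (nat \<Rightarrow> complex) \<Rightarrow> (nat \<Rightarrow> complex) \<Rightarrow> nat \<Rightarrow> complex" where
  "kappa n x y r = (\<Sum>k<n. (\<Prod>t<k. y (idx n (int r + int t))) *
                           (\<Prod>t\<in>{k+1..n-1}. x (idx n (int r + int t))))"

definition Rnew_y :: "nat \<Rightarrow> (nat \<Rightarrow> complex) \<Rightarrow> (nat \<Rightarrow> complex) \<Rightarrow> nat \<Rightarrow> complex" where
  "Rnew_y n x y j = y j * kappa n x y (j + 1) / kappa n x y j"

definition Rnew_x :: "nat \<Rightarrow> (nat \<Rightarrow> complex) \<Rightarrow> (nat \<Rightarrow> complex) \<Rightarrow> nat \<Rightarrow> complex" where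
  "Rnew_x n x y j = x j * kappa n x y j / kappa n x y (j + 1)"

definition row :: "(nat \<times> nat \<Rightarrow> complex) \<Rightarrow> nat \<Rightarrow> nat \<Rightarrow> complex" where
  "row X i = (\<lambda>j. X (i, j))"

definition Rop :: "nat \<Rightarrow> nat \<Rightarrow> (nat \<times> nat \<Rightarrow> complex) \<Rightarrow> (nat \<times> nat \<Rightarrow> complex)" where
  "Rop n i X = (\<lambda>(a, j).
     if a = i then Rnew_y n (row X i) (row X (i+1)) j
     else if a = i + 1 then Rnew_x n (row X i) (row X (i+1)) j
     else X (a, j))"

definition Rdefined :: "nat \<Rightarrow> nat \<Rightarrow> (nat \<times> nat \<Rightarrow> complex) \<Rightarrow> bool" where
  "Rdefined n i X = (\<forall>r\<in>{1..n}. kappa n (row X i) (row X (i+1)) r \<noteq> 0)"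

text \<open>f is fixed by R_i as a rational function: equal on the (dense) domain of R_i.\<close>
definition R_invariant :: "nat \<Rightarrow> nat \<Rightarrow> ((nat \<times> nat \<Rightarrow> complex) \<Rightarrow> complex) \<Rightarrow> bool" where
  "R_invariant n i f = (\<forall>X. Rdefined n i X \<longrightarrow> f (Rop n i X) = f X)"

end

theory Submission
  imports Defs "HOL-Computational_Algebra.Polynomial"
begin

text \<open>
  The hard inclusion is an induction that adds zeros along coordinate subspaces.

  Two rows \<open>x\<close>, \<open>y\<close>: an \<open>R\<close>-invariant polynomial \<open>f\<close> is a polynomial in
  \<open>x\<^sub>r + y\<^sub>r\<^sub>-\<^sub>1\<close> and \<open>x\<^sub>r y\<^sub>r\<close>. Suppose this is known for the restrictions of \<open>f\<close> to \<open>y\<^sub>n = 0\<close> and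
  to \<open>x\<^sub>n = 0\<close>, which \<open>R\<close> interchanges; after subtraction \<open>f\<close> vanishes on both, is divisible by
  \<open>x\<^sub>n y\<^sub>n\<close>, and the quotient is an invariant of smaller degree. The same descent handles
  the restrictions, as pairs of polynomials on \<open>y\<^sub>N = ... = y\<^sub>n = 0\<close> and \<open>x\<^sub>N = ... = x\<^sub>n = 0\<close>
  matched by \<open>R\<close>, down to \<open>y = 0\<close>, where \<open>R\<close> is a cyclic shift.

  All rows: restrict an invariant \<open>f\<close> to the subspace where the entries of the last row in the
  columns \<open>J\<close> vanish, remembering only that it is invariant under all but the last \<open>R\<^sub>i\<close> and
  is a polynomial in the two-row invariants of the last two rows. If \<open>J\<close> is everything, one row
  has disappeared. Otherwise take \<open>j\<close> outside \<open>J\<close>: after subtracting a polynomial in the \<open>e\<^sub>k\<close>,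
  \<open>f\<close> vanishes where the last entry of column \<open>j\<close> does. The two-row invariants being
  algebraically independent, \<open>f\<close> is then divisible by the last two entries of column \<open>j\<close>, hence,
  by the other \<open>R\<^sub>i\<close>, by the product of the whole column, which is an \<open>e\<^sub>m\<close>.\<close>

section \<open>Polynomial functions and coordinate subspaces\<close>

lemma pfun_mono: "f \<in> pfun V \<Longrightarrow> V \<subseteq> W \<Longrightarrow> f \<in> pfun W"
  by (induction rule: pfun.induct) (auto intro: pfun.intros)

lemma pfun_cong:
  assumes "f \<in> pfun V" "\<And>v. v \<in> V \<Longrightarrow> X v = Y v"
  shows "f X = f Y"
  using assms by (induction rule: pfun.induct) auto

lemma pfun_comp:
  assumes "f \<in> pfun V" "\<And>v. v \<in> V \<Longrightarrow> (\<lambda>X. G X v) \<in> pfun W"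
  shows "(\<lambda>X. f (G X)) \<in> pfun W"
  using assms by (induction rule: pfun.induct) (auto intro: pfun.intros)

lemma pfun_uminus: "f \<in> pfun V \<Longrightarrow> (\<lambda>X. - f X) \<in> pfun V"
  using pmult[OF pconst[of "-1"]] by force

lemma pfun_diff: "f \<in> pfun V \<Longrightarrow> g \<in> pfun V \<Longrightarrow> (\<lambda>X. f X - g X) \<in> pfun V"
  using padd[OF _ pfun_uminus] by force

lemma pfun_sum: "(\<And>a. a \<in> A \<Longrightarrow> f a \<in> pfun V) \<Longrightarrow> (\<lambda>X. \<Sum>a\<in>A. f a X) \<in> pfun V"
  by (induction A rule: infinite_finite_induct) (auto intro: pfun.intros)

lemma pfun_prod: "(\<And>a. a \<in> A \<Longrightarrow> f a \<in> pfun V) \<Longrightarrow> (\<lambda>X. \<Prod>a\<in>A. f a X) \<in> pfun V"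
  by (induction A rule: infinite_finite_induct) (auto intro: pfun.intros)

lemma pfun_power: "f \<in> pfun V \<Longrightarrow> (\<lambda>X. f X ^ k) \<in> pfun V"
  by (induction k) (auto intro: pfun.intros)

lemmas pfun_intros = pfun.intros pfun_uminus pfun_diff pfun_sum pfun_prod pfun_power

section \<open>Restriction to lines and density in coordinate subspaces\<close>

lemma pfun_on_line:
  assumes "f \<in> pfun V"
  shows "\<exists>p. \<forall>t. f (\<lambda>v. a v + t * (b v - a v)) = poly p t"
  using assms
proof (induction rule: pfun.induct)
  case (pconst c)
  show ?case by (rule exI[of _ "[:c:]"]) simp
next
  case (pvar v)
  show ?case by (rule exI[of _ "[:a v, b v - a v:]"]) simp
next
  case (padd f g)
  then show ?case by (metis poly_add)
next
  case (pmult f g)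
  then show ?case by (metis poly_mult)
qed

definition zs :: "'v set \<Rightarrow> ('v \<Rightarrow> complex) set" where
  "zs B = {X. \<forall>v\<in>B. X v = 0}"

lemma zs_line: "a \<in> zs B \<Longrightarrow> b \<in> zs B \<Longrightarrow> (\<lambda>v. a v + t * (b v - a v)) \<in> zs B"
  by (simp add: zs_def)

text \<open>On the line through \<open>X\<close> (parameter 0) and \<open>b\<close> (parameter 1),
  \<open>f\<close> and \<open>g\<close> become univariate polynomials with product zero. The second
  is nonzero at 1, so the first is the zero polynomial.\<close>

lemma pfun_eq_0_dense:
  assumes f: "f \<in> pfun V" and g: "g \<in> pfun W"
    and fg: "\<And>X. X \<in> zs B \<Longrightarrow> f X * g X = 0"
    and b: "b \<in> zs B" "g b \<noteq> 0" and X: "X \<in> zs B"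
  shows "f X = 0"
proof -
  obtain p where p: "\<And>t. f (\<lambda>v. X v + t * (b v - X v)) = poly p t"
    using pfun_on_line[OF f] by metis
  obtain q where q: "\<And>t. g (\<lambda>v. X v + t * (b v - X v)) = poly q t"
    using pfun_on_line[OF g] by metis
  have "poly (p * q) t = 0" for t
    using fg[OF zs_line[OF X b(1)]] p q by simp
  then have "p * q = 0"
    by (metis poly_all_0_iff_0)
  moreover have "poly q 1 \<noteq> 0"
    using q[of 1] b by simp
  ultimately have "p = 0" by auto
  then show ?thesis using p[of 0] by simp
qed

text \<open>Weighted degree at most \<open>d\<close>. The bound is an integer so that dividing by a variable can
  always lower it: a negative bound forces the zero function.\<close>
inductive wdeg :: "'v set \<Rightarrow> ('v \<Rightarrow> nat) \<Rightarrow> int \<Rightarrow> (('v \<Rightarrow> complex) \<Rightarrow> complex) \<Rightarrow> bool"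
  for V :: "'v set" and w :: "'v \<Rightarrow> nat" where
  zero: "wdeg V w d (\<lambda>X. 0)"
| const: "0 \<le> d \<Longrightarrow> wdeg V w d (\<lambda>X. c)"
| var: "v \<in> V \<Longrightarrow> int (w v) \<le> d \<Longrightarrow> wdeg V w d (\<lambda>X. X v)"
| add: "wdeg V w d f \<Longrightarrow> wdeg V w d g \<Longrightarrow> wdeg V w d (\<lambda>X. f X + g X)"
| mult: "wdeg V w a f \<Longrightarrow> wdeg V w b g \<Longrightarrow> a + b \<le> d \<Longrightarrow> wdeg V w d (\<lambda>X. f X * g X)"

definition pdeg :: "'v set \<Rightarrow> ('v \<Rightarrow> nat) \<Rightarrow> int \<Rightarrow> (('v \<Rightarrow> complex) \<Rightarrow> complex) set" where
  "pdeg V w d = {f. wdeg V w d f}"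

lemma wdeg_pdeg_eq: "wdeg V w d f \<longleftrightarrow> f \<in> pdeg V w d"
  by (simp add: pdeg_def)

lemmas pdeg_zero = wdeg.zero[unfolded wdeg_pdeg_eq]
lemmas pdeg_const = wdeg.const[unfolded wdeg_pdeg_eq]
lemmas pdeg_var = wdeg.var[unfolded wdeg_pdeg_eq]
lemmas pdeg_add = wdeg.add[unfolded wdeg_pdeg_eq]
lemmas pdeg_mult = wdeg.mult[unfolded wdeg_pdeg_eq]
lemmas pdeg_induct [consumes 1, case_names zero const var add mult] =
  wdeg.induct[unfolded wdeg_pdeg_eq]

lemma pdeg_mono_degree: "f \<in> pdeg V w d \<Longrightarrow> d \<le> d' \<Longrightarrow> f \<in> pdeg V w d'"
proof (induction arbitrary: d' rule: pdeg_induct)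
  case (mult a f b g d)
  then show ?case using pdeg_mult[of f V w a g b d'] by simp
qed (auto intro: pdeg_zero pdeg_const pdeg_var pdeg_add)

lemma pdeg_mono: "f \<in> pdeg V w d \<Longrightarrow> V \<subseteq> W \<Longrightarrow> f \<in> pdeg W w d"
proof (induction rule: pdeg_induct)
  case (mult a f b g d)
  then show ?case using pdeg_mult[of f W w a g b d] by simp
qed (auto intro: pdeg_zero pdeg_const pdeg_var pdeg_add)

lemma pdeg_imp_pfun: "f \<in> pdeg V w d \<Longrightarrow> f \<in> pfun V"
  by (induction rule: pdeg_induct) (auto intro: pfun.intros)

lemma pfun_imp_pdeg: "f \<in> pfun V \<Longrightarrow> \<exists>d\<ge>0. f \<in> pdeg V w d"
proof (induction rule: pfun.induct)
  case (pconst c)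
  then show ?case by (auto intro: pdeg_const)
next
  case (pvar v)
  then show ?case by (auto intro!: exI[of _ "int (w v)"] pdeg_var)
next
  case (padd f g)
  then obtain a b where "a \<ge> 0" "b \<ge> 0" "f \<in> pdeg V w a" "g \<in> pdeg V w b" by auto
  then have "(\<lambda>X. f X + g X) \<in> pdeg V w (max a b)"
    by (intro pdeg_add) (auto elim!: pdeg_mono_degree)
  then show ?case using \<open>a \<ge> 0\<close> by (intro exI[of _ "max a b"]) auto
next
  case (pmult f g)
  then obtain a b where "a \<ge> 0" "b \<ge> 0" "f \<in> pdeg V w a" "g \<in> pdeg V w b" by auto
  then show ?case
    using pdeg_mult[of f V w a g b "a + b"] by (intro exI[of _ "a + b"]) auto
qed

text \<open>Start of all degree descents: in a product with a negative bound, one of the factors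
  already has a negative bound.\<close>

lemma pdeg_neg: "f \<in> pdeg V w d \<Longrightarrow> d < 0 \<Longrightarrow> f X = 0"
proof (induction rule: pdeg_induct)
  case (mult a f b g d)
  then have "a < 0 \<or> b < 0" by linarith
  then show ?case using mult by auto
qed auto

text \<open>The weight of a variable is the degree of what will be substituted for it, so a bound on
  a polynomial in invariants is a bound on its expansion in the entries.\<close>

lemma pdeg_comp:
  assumes "f \<in> pdeg V w d" "\<And>v. v \<in> V \<Longrightarrow> (\<lambda>X. G X v) \<in> pdeg W w' (int (w v))"
  shows "(\<lambda>X. f (G X)) \<in> pdeg W w' d"
  using assms
proof (induction rule: pdeg_induct)
  case (mult a f b g d)
  then show ?case using pdeg_mult[of "\<lambda>X. f (G X)" W w' a "\<lambda>X. g (G X)" b d] by simp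
next
  case (var v d)
  then show ?case using pdeg_mono_degree[of "\<lambda>X. G X v" W w' "int (w v)" d] by auto
qed (auto intro: pdeg_zero pdeg_const pdeg_add)

lemma pdeg_uminus: "f \<in> pdeg V w d \<Longrightarrow> (\<lambda>X. - f X) \<in> pdeg V w d"
  using pdeg_mult[OF pdeg_const[of 0 "-1" V w], of f d d] by simp

lemma pdeg_diff: "f \<in> pdeg V w d \<Longrightarrow> g \<in> pdeg V w d \<Longrightarrow> (\<lambda>X. f X - g X) \<in> pdeg V w d"
  using pdeg_add[OF _ pdeg_uminus[of g], of f V w d] by simp

lemma pdeg_sum: "(\<And>a. a \<in> A \<Longrightarrow> f a \<in> pdeg V w d) \<Longrightarrow> (\<lambda>X. \<Sum>a\<in>A. f a X) \<in> pdeg V w d"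
  by (induction A rule: infinite_finite_induct) (auto intro: pdeg_zero pdeg_add)

lemma pdeg_prod:
  "(\<And>a. a \<in> A \<Longrightarrow> f a \<in> pdeg V w (int (e a))) \<Longrightarrow>
    (\<lambda>X. \<Prod>a\<in>A. f a X) \<in> pdeg V w (int (\<Sum>a\<in>A. e a))"
proof (induction A rule: infinite_finite_induct)
  case (insert a A)
  then show ?case
    using pdeg_mult[of "f a" V w "int (e a)" "\<lambda>X. \<Prod>a\<in>A. f a X" "int (\<Sum>a\<in>A. e a)"] by simp
qed (auto intro: pdeg_const)

section \<open>Division by variables\<close>

text \<open>The quotient is built along the derivation of the bound, so that it comes with the bound
  lowered by \<open>w v\<close>; this makes the later descents terminate.\<close>

lemma pdeg_split_var:
  assumes "f \<in> pdeg V w d"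
  shows "\<exists>h\<in>pdeg V w (d - int (w v)). \<forall>X. f X = f (X(v := 0)) + X v * h X"
  using assms
proof (induction rule: pdeg_induct)
  case (zero d)
  show ?case by (rule bexI[of _ "\<lambda>X. 0"]) (auto intro: pdeg_zero)
next
  case (const d c)
  show ?case by (rule bexI[of _ "\<lambda>X. 0"]) (auto intro: pdeg_zero)
next
  case (var u d)
  show ?case
  proof (cases "u = v")
    case True
    show ?thesis
      by (rule bexI[of _ "\<lambda>X. 1"]) (use True var in \<open>auto intro: pdeg_const\<close>)
  next
    case False
    show ?thesis
      by (rule bexI[of _ "\<lambda>X. 0"]) (use False in \<open>auto intro: pdeg_zero\<close>)
  qed
next
  case (add d f g)
  obtain h where h: "h \<in> pdeg V w (d - int (w v))" "\<And>X. f X = f (X(v := 0)) + X v * h X"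
    using add.IH by blast
  obtain k where k: "k \<in> pdeg V w (d - int (w v))" "\<And>X. g X = g (X(v := 0)) + X v * k X"
    using add.IH by blast
  have "f X + g X = f (X(v := 0)) + g (X(v := 0)) + X v * (h X + k X)" for X
    by (subst h, subst k) (simp add: algebra_simps)
  then show ?case by (intro bexI[OF _ pdeg_add[OF h(1) k(1)]] allI)
next
  case (mult a f b g d)
  obtain h where h: "h \<in> pdeg V w (a - int (w v))"
    and fh: "\<And>X. f X = f (X(v := 0)) + X v * h X"
    using mult.IH by blast
  obtain k where k: "k \<in> pdeg V w (b - int (w v))"
    and gk: "\<And>X. g X = g (X(v := 0)) + X v * k X"
    using mult.IH by blast
  have f0: "(\<lambda>X. f (X(v := 0))) \<in> pdeg V w a"
  proof (rule pdeg_comp[OF mult.hyps(1)])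
    show "(\<lambda>X. (X(v := 0)) u) \<in> pdeg V w (int (w u))" if "u \<in> V" for u
      using that by (cases "u = v") (auto intro: pdeg_zero pdeg_var)
  qed
  \<comment> \<open>A discrete product rule: the change of the product is the change of
    \<open>f\<close> times \<open>g\<close> plus the value of \<open>f\<close> at
    \<open>v = 0\<close> times the change of \<open>g\<close>.\<close>
  have "(\<lambda>X. h X * g X + f (X(v := 0)) * k X) \<in> pdeg V w (d - int (w v))"
    using mult.hyps by (intro pdeg_add pdeg_mult[OF h mult.hyps(2)] pdeg_mult[OF f0 k]) auto
  then show ?case
  proof (rule bexI[rotated], intro allI)
    fix X
    show "f X * g X = f (X(v := 0)) * g (X(v := 0)) + X v * (h X * g X + f (X(v := 0)) * k X)"
  proof -
    have "f X * g X = f (X(v := 0)) * g X + X v * h X * g X"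
      by (subst fh) (simp add: algebra_simps)
    also have "f (X(v := 0)) * g X = f (X(v := 0)) * g (X(v := 0)) + f (X(v := 0)) * (X v * k X)"
      by (subst gk) (simp add: algebra_simps)
    finally show ?thesis by (simp add: algebra_simps)
  qed
  qed
qed

lemma pdeg_divide_var:
  assumes "f \<in> pdeg V w d" "\<And>X. X \<in> zs (insert v B) \<Longrightarrow> f X = 0"
  shows "\<exists>h\<in>pdeg V w (d - int (w v)). \<forall>X\<in>zs B. f X = X v * h X"
proof -
  obtain h where h: "h \<in> pdeg V w (d - int (w v))" "\<And>X. f X = f (X(v := 0)) + X v * h X"
    using pdeg_split_var[OF assms(1), of v] by metis
  have "f (X(v := 0)) = 0" if "X \<in> zs B" for X
    using that by (intro assms(2)) (auto simp: zs_def)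
  then show ?thesis using h by (metis add_0)
qed

text \<open>Witness for density arguments: a point of \<open>zs B\<close> at which every product of
  variables outside \<open>B\<close> is nonzero.\<close>

definition off :: "'v set \<Rightarrow> 'v \<Rightarrow> complex" where
  "off B v = (if v \<in> B then 0 else 1)"

lemma off_in_zs: "off B \<in> zs B"
  by (simp add: off_def zs_def)

text \<open>The variables are divided out one at a time. The quotient by those in \<open>A\<close>
  still vanishes where the next variable \<open>v\<close> does, because the product over
  \<open>A\<close> is not identically zero on \<open>zs (insert v B)\<close>.\<close>

lemma pdeg_divide_vars:
  assumes "finite A" "f \<in> pdeg V w d" "A \<inter> B = {}" "A \<subseteq> V"
    "\<And>v X. v \<in> A \<Longrightarrow> X \<in> zs (insert v B) \<Longrightarrow> f X = 0"
  shows "\<exists>h\<in>pdeg V w (d - int (\<Sum>v\<in>A. w v)). \<forall>X\<in>zs B. f X = (\<Prod>v\<in>A. X v) * h X"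
  using assms(1,3-5)
proof (induction A rule: finite_induct)
  case empty
  show ?case using assms(2) by auto
next
  case (insert v A)
  have "\<exists>h\<in>pdeg V w (d - int (\<Sum>v\<in>A. w v)). \<forall>X\<in>zs B. f X = (\<Prod>v\<in>A. X v) * h X"
    using insert.prems by (intro insert.IH) auto
  then obtain h where h: "h \<in> pdeg V w (d - int (\<Sum>v\<in>A. w v))"
    and fh: "\<And>X. X \<in> zs B \<Longrightarrow> f X = (\<Prod>v\<in>A. X v) * h X"
    by blast
  have "h X = 0" if X: "X \<in> zs (insert v B)" for X
  proof (rule pfun_eq_0_dense[OF pdeg_imp_pfun[OF h], where g="\<lambda>X. \<Prod>v\<in>A. X v" and W=V])
    show "(\<lambda>X. \<Prod>v\<in>A. X v) \<in> pfun V" using insert by (auto intro!: pfun_intros)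
    show "h X * (\<Prod>v\<in>A. X v) = 0" if "X \<in> zs (insert v B)" for X
    proof -
      have "X \<in> zs B" using that by (auto simp: zs_def)
      then show ?thesis using fh[of X] insert.prems(3)[of v X] that by auto
    qed
    show "(\<Prod>u\<in>A. off (insert v B) u) \<noteq> 0"
      using insert by (auto simp: off_def)
  qed (use X off_in_zs in auto)
  then obtain k where "k \<in> pdeg V w (d - int (\<Sum>v\<in>A. w v) - int (w v))"
    "\<And>X. X \<in> zs B \<Longrightarrow> h X = X v * k X"
    using pdeg_divide_var[OF h] by metis
  moreover have "d - int (\<Sum>v\<in>A. w v) - int (w v) = d - int (\<Sum>u\<in>insert v A. w u)"
    using insert.hyps by simp
  moreover have "f X = (\<Prod>u\<in>insert v A. X u) * k X" if "X \<in> zs B" "h X = X v * k X" for X k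
    using insert.hyps fh[OF that(1)] that(2) by (simp add: mult_ac)
  ultimately show ?case by metis
qed

section \<open>Rational functions with a prescribed denominator\<close>

text \<open>\<open>F\<close> is a regular function on the open set where \<open>q\<close> is
  nonzero. Nothing is required at the zeros of \<open>q\<close>, where quotients take the
  conventional value 0.\<close>

definition rfun :: "(('v \<Rightarrow> complex) \<Rightarrow> complex) \<Rightarrow> (('v \<Rightarrow> complex) \<Rightarrow> complex) \<Rightarrow> bool" where
  "rfun q F \<longleftrightarrow> (\<exists>M. \<exists>h\<in>pfun UNIV. \<forall>X. q X \<noteq> 0 \<longrightarrow> F X * q X ^ M = h X)"

lemma rfun_pfun: "f \<in> pfun V \<Longrightarrow> rfun q f"
  unfolding rfun_def by (rule exI[of _ 0]) (auto intro: pfun_mono)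

lemma rfun_divide:
  assumes "p \<in> pfun UNIV" "b \<in> pfun UNIV" "\<And>X. q X = a X * b X"
  shows "rfun q (\<lambda>X. p X / a X)"
  unfolding rfun_def
  by (rule exI[of _ 1], rule bexI[of _ "\<lambda>X. p X * b X"]) (use assms in \<open>auto intro: pfun_intros\<close>)

lemma rfun_add:
  assumes "q \<in> pfun UNIV" "rfun q F" "rfun q G"
  shows "rfun q (\<lambda>X. F X + G X)"
proof -
  obtain M h N k where "h \<in> pfun UNIV" "\<And>X. q X \<noteq> 0 \<Longrightarrow> F X * q X ^ M = h X"
    "k \<in> pfun UNIV" "\<And>X. q X \<noteq> 0 \<Longrightarrow> G X * q X ^ N = k X"
    using assms(2,3) unfolding rfun_def by auto
  then show ?thesis
    unfolding rfun_def using assms(1)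
    by (intro exI[of _ "M + N"] bexI[of _ "\<lambda>X. h X * q X ^ N + k X * q X ^ M"])
      (auto intro!: pfun_intros simp: algebra_simps power_add)
qed

lemma rfun_mult:
  assumes "rfun q F" "rfun q G"
  shows "rfun q (\<lambda>X. F X * G X)"
proof -
  obtain M h N k where hk: "h \<in> pfun UNIV" "\<And>X. q X \<noteq> 0 \<Longrightarrow> F X * q X ^ M = h X"
    "k \<in> pfun UNIV" "\<And>X. q X \<noteq> 0 \<Longrightarrow> G X * q X ^ N = k X"
    using assms unfolding rfun_def by auto
  have "F X * G X * q X ^ (M + N) = h X * k X" if "q X \<noteq> 0" for X
    using hk(2,4)[OF that] by (metis power_add mult.assoc mult.left_commute)
  then show ?thesis
    unfolding rfun_def using hk
    by (intro exI[of _ "M + N"] bexI[of _ "\<lambda>X. h X * k X"]) (auto intro!: pfun_intros)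
qed

lemma rfun_comp:
  assumes "f \<in> pfun V" "q \<in> pfun UNIV" "\<And>v. v \<in> V \<Longrightarrow> rfun q (\<lambda>X. G X v)"
  shows "rfun q (\<lambda>X. f (G X))"
  using assms
  by (induction rule: pfun.induct) (auto intro: rfun_add rfun_mult rfun_pfun[OF pconst])

lemma rfun_eq_dense:
  assumes q: "q \<in> pfun UNIV" and F: "rfun q F" and G: "rfun q G" and g: "g \<in> pfun UNIV"
    and b: "b \<in> zs B" "g b \<noteq> 0"
    and eq: "\<And>X. X \<in> zs B \<Longrightarrow> q X \<noteq> 0 \<Longrightarrow> g X \<noteq> 0 \<Longrightarrow> F X = G X"
    and X: "X \<in> zs B" "q X \<noteq> 0"
  shows "F X = G X"
proof -
  obtain M h N k where h: "h \<in> pfun UNIV" "\<And>X. q X \<noteq> 0 \<Longrightarrow> F X * q X ^ M = h X"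
    and k: "k \<in> pfun UNIV" "\<And>X. q X \<noteq> 0 \<Longrightarrow> G X * q X ^ N = k X"
    using F G unfolding rfun_def by auto
  \<comment> \<open>The extra factor \<open>q X\<close> makes the cleared difference vanish at the
    zeros of \<open>q\<close>, where nothing is known about \<open>F\<close> and
    \<open>G\<close>.\<close>
  let ?d = "\<lambda>X. q X * (h X * q X ^ N - k X * q X ^ M)"
  have d: "?d \<in> pfun UNIV" using q h k by (auto intro!: pfun_intros)
  have "?d Y * g Y = 0" if "Y \<in> zs B" for Y
  proof (cases "q Y = 0 \<or> g Y = 0")
    case False
    then have "h Y = F Y * q Y ^ M" "k Y = F Y * q Y ^ N"
      using eq[OF that] h(2)[of Y] k(2)[of Y] by auto
    then show ?thesis by (simp add: mult_ac)
  qed auto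
  from pfun_eq_0_dense[OF d g this b X(1)] have "h X * q X ^ N = k X * q X ^ M"
    using X(2) by simp
  then have "F X * (q X ^ M * q X ^ N) = G X * (q X ^ M * q X ^ N)"
    using h(2)[OF X(2)] k(2)[OF X(2)] by (metis mult.assoc mult.commute)
  then show ?thesis using X(2) by simp
qed

section \<open>The R-matrix on two rows\<close>

type_synonym mat = "nat \<times> nat \<Rightarrow> complex"

definition prv :: "nat \<Rightarrow> nat \<Rightarrow> nat" where
  "prv n r = (if r = 1 then n else r - 1)"

text \<open>The loop elementary symmetric functions of the two rows, stored in place of these rows,
  so that a polynomial in them and in the other entries is again a function of a matrix.\<close>

definition sym2 :: "nat \<Rightarrow> nat \<Rightarrow> mat \<Rightarrow> mat" where
  "sym2 n i X = (\<lambda>(k, r).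
     if k = i then X (i, r) + X (Suc i, prv n r)
     else if k = Suc i then X (i, r) * X (Suc i, r)
     else X (k, r))"

text \<open>With x and y for rows \<open>i\<close> and \<open>Suc i\<close> and r at most N, this is
  the sum over k from r to N of y_r ... y_(k-1) x_(k+1) ... x_N. For N = n it is what remains of
  \<open>kappa\<close> on y_n = 0, see \<open>kappa_eq_rho\<close>.\<close>

function rho :: "nat \<Rightarrow> nat \<Rightarrow> mat \<Rightarrow> nat \<Rightarrow> complex" where
  "rho i N X r =
     (if r < N then (\<Prod>s\<in>{r<..N}. X (i, s)) + X (Suc i, r) * rho i N X (Suc r) else 1)"
  by auto
termination by (relation "measure (\<lambda>(i, N, X, r). N - r)") auto

declare rho.simps [simp del]

lemma rho_end: "N \<le> r \<Longrightarrow> rho i N X r = 1"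
  by (simp add: rho.simps)

lemma rho_step:
  "r < N \<Longrightarrow> rho i N X r = (\<Prod>s\<in>{r<..N}. X (i, s)) + X (Suc i, r) * rho i N X (Suc r)"
  by (subst rho.simps) simp

text \<open>The counterpart for x_n = 0, see \<open>kappa_eq_sig\<close>: the sum over k from 0 to r
  of y_0 ... y_(k-1) x_(k+1) ... x_r, with y_0 read as y_n.\<close>

fun sig :: "nat \<Rightarrow> nat \<Rightarrow> mat \<Rightarrow> nat \<Rightarrow> complex" where
  "sig n i X 0 = 1"
| "sig n i X (Suc r) =
     X (Suc i, n) * (\<Prod>s\<in>{1..r}. X (Suc i, s)) + X (i, Suc r) * sig n i X r"

text \<open>On the subspace \<open>y\<^sub>N = ... = y\<^sub>n = 0\<close>, \<open>psi\<close> is \<open>R\<close> with the common factors of the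
  \<open>kappa\<close> cancelled; \<open>psi'\<close> is the same for \<open>x\<^sub>N = ... = x\<^sub>n = 0\<close>. The remaining denominators
  \<open>rho\<close> are generically nonzero on \<open>x\<^sub>N\<^sub>-\<^sub>1 = 0\<close>, where some \<open>kappa\<close> vanish identically: this is
  what carries vanishing from \<open>y\<^sub>N\<^sub>-\<^sub>1 = 0\<close> over to \<open>x\<^sub>N\<^sub>-\<^sub>1 = 0\<close>.\<close>
definition psi :: "nat \<Rightarrow> nat \<Rightarrow> nat \<Rightarrow> mat \<Rightarrow> mat" where
  "psi n i N X = (\<lambda>(k, r).
     if k = i then
       (if r < N then X (i, r) * X (Suc i, r) * rho i N X (Suc r) / rho i N X r else 0)
     else if k = Suc i then
       (if r < N then rho i N X r / rho i N X (Suc r)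
        else if r < n then X (i, Suc r)
        else (\<Prod>s\<in>{1..N}. X (i, s)) / rho i N X 1)
     else X (k, r))"

definition psi' :: "nat \<Rightarrow> nat \<Rightarrow> nat \<Rightarrow> mat \<Rightarrow> mat" where
  "psi' n i N X = (\<lambda>(k, r).
     if k = i then
       (if r < N then sig n i X r / sig n i X (r - 1)
        else if r = N then X (Suc i, n) * (\<Prod>s\<in>{1..N - 1}. X (Suc i, s)) / sig n i X (N - 1)
        else X (Suc i, r - 1))
     else if k = Suc i then
       (if r < N then X (i, r) * X (Suc i, r) * sig n i X (r - 1) / sig n i X r else 0)
     else X (k, r))"

abbreviation tail :: "nat \<Rightarrow> nat \<Rightarrow> nat \<Rightarrow> (nat \<times> nat) set" where
  "tail n i N \<equiv> {i} \<times> {N..n}"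

lemma rho_pfun: "(\<lambda>X. rho i N X r) \<in> pfun UNIV"
proof (induction "N - r" arbitrary: r)
  case 0
  then show ?case by (simp add: rho_end pconst)
next
  case (Suc k)
  then have "(\<lambda>X. rho i N X (Suc r)) \<in> pfun UNIV" by simp
  then have "(\<lambda>X. (\<Prod>s\<in>{r<..N}. X (i, s)) + X (Suc i, r) * rho i N X (Suc r)) \<in> pfun UNIV"
    by (auto intro!: pfun_intros)
  then show ?case using Suc(2) by (simp add: rho_step)
qed

lemma sig_pfun: "(\<lambda>X. sig n i X r) \<in> pfun UNIV"
  by (induction r) (auto intro!: pfun_intros)

context
  fixes n i N :: nat
  assumes N: "1 \<le> N" "N \<le> n"
begin

text \<open>For r < N the \<open>rho\<close> quotients cancel in the products; for larger r the
  products are zero. The sums agree by the three-term relation x_r y_r rho_(r+1) + rho_(r-1) = (x_r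
  + y_(r-1)) rho_r, obtained by unfolding \<open>rho\<close> twice.\<close>

lemma sym2_psi:
  assumes X: "X \<in> zs (tail n (Suc i) N)"
    and nz: "\<And>r. r \<in> {1..<N} \<Longrightarrow> rho i N X r \<noteq> 0"
    and r: "r \<in> {1..n}"
  shows "sym2 n i (psi n i N X) (k, r) = sym2 n i X (k, r)"
proof -
  have y0: "X (Suc i, s) = 0" if "N \<le> s" "s \<le> n" for s
    using X that by (auto simp: zs_def)
  have c: "psi n i N X (i, r) + psi n i N X (Suc i, prv n r) = X (i, r) + X (Suc i, prv n r)"
  proof (cases "r = 1")
    \<comment> \<open>Column 1 is preceded by column n, where the second row vanishes, so only x_1
      is left on the right. The last branch of \<open>psi\<close> supplies exactly the term missing
      on the left.\<close>
    case True
    show ?thesis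
    proof (cases "N = 1")
      case True
      then show ?thesis using \<open>r = 1\<close> N y0[of n] by (auto simp: psi_def prv_def rho_end)
    next
      case False
      then have N2: "1 < N" using N by simp
      have "(\<Prod>s\<in>{1..N}. X (i, s)) = X (i, 1) * (\<Prod>s\<in>{1<..N}. X (i, s))"
        using N by (simp add: prod.head)
      moreover have "rho i N X 1 = (\<Prod>s\<in>{1<..N}. X (i, s)) + X (Suc i, 1) * rho i N X (Suc 1)"
        by (rule rho_step[OF N2])
      ultimately have "X (i, 1) * X (Suc i, 1) * rho i N X (Suc 1) + (\<Prod>s\<in>{1..N}. X (i, s))
          = X (i, 1) * rho i N X 1"
        by (simp add: algebra_simps)
      then show ?thesis using True N N2 y0[of n] nz[of 1]
        by (auto simp: psi_def prv_def field_simps simp flip: add_divide_distrib)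
    qed
  next
    case False
    then obtain p where p: "r = Suc p" "1 \<le> p" using r by (cases r) auto
    consider "r < N" | "r = N" | "N < r" by linarith
    then show ?thesis
    proof cases
      case 1
      have "rho i N X p = X (i, r) * (\<Prod>s\<in>{r<..N}. X (i, s)) + X (Suc i, p) * rho i N X r"
        using 1 p by (simp add: rho_step prod.head atLeastSucAtMost_greaterThanAtMost[symmetric])
      moreover have "rho i N X r = (\<Prod>s\<in>{r<..N}. X (i, s)) + X (Suc i, r) * rho i N X (Suc r)"
        by (rule rho_step[OF 1])
      ultimately have "X (i, r) * X (Suc i, r) * rho i N X (Suc r) + rho i N X p
          = (X (i, r) + X (Suc i, p)) * rho i N X r"
        by (simp add: algebra_simps)
      then show ?thesis using 1 p r nz[of r]
        by (simp add: psi_def prv_def field_simps flip: add_divide_distrib)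
    next
      case 2
      then show ?thesis using p r
        by (simp add: psi_def prv_def rho_end rho_step
            atLeastSucAtMost_greaterThanAtMost[symmetric])
    next
      case 3
      then show ?thesis using p r y0[of p] by (simp add: psi_def prv_def)
    qed
  qed
  have d: "psi n i N X (i, r) * psi n i N X (Suc i, r) = X (i, r) * X (Suc i, r)"
  proof (cases "r < N")
    case True
    have "rho i N X (Suc r) \<noteq> 0"
      using True r nz[of "Suc r"] by (cases "Suc r < N") (auto simp: rho_end)
    then show ?thesis using True r nz[of r] by (simp add: psi_def)
  next
    case False
    then show ?thesis using y0[of r] r by (simp add: psi_def)
  qed
  show ?thesis using c d by (auto simp: sym2_def psi_def)
qed

text \<open>As for \<open>psi\<close>, now from sig_r + x_(r-1) y_(r-1) sig_(r-2) = (x_r + y_(r-1))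
  sig_(r-1), which at r = N is used with x_N = 0.\<close>

lemma sym2_psi':
  assumes X: "X \<in> zs (tail n i N)"
    and nz: "\<And>r. r \<in> {1..<N} \<Longrightarrow> sig n i X r \<noteq> 0"
    and r: "r \<in> {1..n}"
  shows "sym2 n i (psi' n i N X) (k, r) = sym2 n i X (k, r)"
proof -
  have x0: "X (i, s) = 0" if "N \<le> s" "s \<le> n" for s
    using X that by (auto simp: zs_def)
  have nz0: "sig n i X s \<noteq> 0" if "s < N" for s
    using nz[of s] that by (cases s) auto
  have c: "psi' n i N X (i, r) + psi' n i N X (Suc i, prv n r) = X (i, r) + X (Suc i, prv n r)"
  proof (cases "r = 1")
    case True
    then show ?thesis using N x0[of 1]
      by (cases "N = 1") (auto simp: psi'_def prv_def)
  next
    case False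
    then obtain q where q: "r = Suc (Suc q)" using r by (cases r; cases "r - 1") auto
    have s1: "sig n i X (Suc q) = X (Suc i, n) * (\<Prod>s\<in>{1..q}. X (Suc i, s)) + X (i, Suc q) * sig n i X q"
      by simp
    have pq: "(\<Prod>s\<in>{1..Suc q}. X (Suc i, s)) = (\<Prod>s\<in>{1..q}. X (Suc i, s)) * X (Suc i, Suc q)"
      by simp
    have key: "X (Suc i, n) * (\<Prod>s\<in>{1..Suc q}. X (Suc i, s)) + X (i, Suc q) * X (Suc i, Suc q) * sig n i X q
        = X (Suc i, Suc q) * sig n i X (Suc q)"
      unfolding s1 pq by (simp add: algebra_simps)
    consider "r < N" | "r = N" | "N < r" by linarith
    then show ?thesis
    proof cases
      case 1
      have "sig n i X r = X (Suc i, n) * (\<Prod>s\<in>{1..Suc q}. X (Suc i, s)) + X (i, r) * sig n i X (Suc q)"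
        unfolding q by (rule sig.simps)
      then have "sig n i X r + X (i, Suc q) * X (Suc i, Suc q) * sig n i X q
          = (X (i, r) + X (Suc i, Suc q)) * sig n i X (Suc q)"
        using key by (simp add: algebra_simps del: sig.simps)
      then show ?thesis using 1 q r nz0[of "Suc q"]
        by (simp add: psi'_def prv_def field_simps flip: add_divide_distrib del: sig.simps)
    next
      case 2
      have NN: "N = Suc (Suc q)" using 2 q by simp
      have "X (i, Suc (Suc q)) = 0" using x0[of r] r 2 q by simp
      moreover have "sig n i X (Suc q) \<noteq> 0" using nz0[of "Suc q"] NN by simp
      ultimately show ?thesis using key
        by (simp add: psi'_def prv_def NN q field_simps flip: add_divide_distrib del: sig.simps)
    next
      case 3
      then show ?thesis using q r x0[of r] by (simp add: psi'_def prv_def)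
    qed
  qed
  have d: "psi' n i N X (i, r) * psi' n i N X (Suc i, r) = X (i, r) * X (Suc i, r)"
  proof (cases "r < N")
    case True
    then show ?thesis using r nz0[of r] nz0[of "r - 1"] by (simp add: psi'_def)
  next
    case False
    then show ?thesis using x0[of r] r by (simp add: psi'_def)
  qed
  show ?thesis using c d by (auto simp: sym2_def psi'_def)
qed

end

section \<open>Compatible pairs and two-row invariants on coordinate subspaces\<close>

text \<open>\<open>f2\<close> matters only on y_N = ... = y_n = 0 and \<open>f1\<close> only on x_N
  = ... = x_n = 0. Two functions are needed because the division by x_N y_N is carried out
  separately on the two subspaces.\<close>

definition compat_pair :: "nat \<Rightarrow> nat \<Rightarrow> nat \<Rightarrow> (mat \<Rightarrow> complex) \<Rightarrow> (mat \<Rightarrow> complex) \<Rightarrow> bool" where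
  "compat_pair n i N f1 f2 \<longleftrightarrow>
     (\<forall>X\<in>zs (tail n (Suc i) N). (\<forall>r\<in>{1..<N}. rho i N X r \<noteq> 0) \<longrightarrow> f2 X = f1 (psi n i N X)) \<and>
     (\<forall>X\<in>zs (tail n i N). (\<forall>r\<in>{1..<N}. sig n i X r \<noteq> 0) \<longrightarrow> f1 X = f2 (psi' n i N X))"

text \<open>The weight of an entry of \<open>sym2\<close> is its degree in the original
  entries.\<close>

definition w2 :: "nat \<Rightarrow> nat \<times> nat \<Rightarrow> nat" where
  "w2 i = (\<lambda>(k, r). if k = Suc i then 2 else 1)"

lemma psi_in_zs: "psi n i N X \<in> zs (tail n i N)"
  by (auto simp: zs_def psi_def)

lemma psi'_in_zs: "psi' n i N X \<in> zs (tail n (Suc i) N)"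
  by (auto simp: zs_def psi'_def)

lemma rfun_divide_factor:
  fixes a :: "nat \<Rightarrow> ('v \<Rightarrow> complex) \<Rightarrow> complex"
  assumes "p \<in> pfun UNIV" "\<And>s. a s \<in> pfun UNIV" "r \<in> {1..<N} \<or> (\<forall>X. a r X = 1)"
  shows "rfun (\<lambda>X. \<Prod>s\<in>{1..<N}. a s X) (\<lambda>X. p X / a r X)"
proof (cases "r \<in> {1..<N}")
  case True
  have "(\<lambda>X. \<Prod>s\<in>{1..<N} - {r}. a s X) \<in> pfun UNIV"
    using assms(2) by (intro pfun_prod)
  then show ?thesis
    using assms(1) True by (intro rfun_divide) (auto simp: prod.remove)
next
  case False
  have "(\<lambda>X. \<Prod>s\<in>{1..<N}. a s X) \<in> pfun UNIV"
    using assms(2) by (intro pfun_prod)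
  then show ?thesis
    using assms(1,3) False by (intro rfun_divide[where b="\<lambda>X. \<Prod>s\<in>{1..<N}. a s X"]) auto
qed

context
  fixes n i :: nat and M :: "nat set" and V
  assumes iM: "i \<in> M" "Suc i \<in> M" and n1: "1 \<le> n"
  defines "V \<equiv> M \<times> {1..n}"
begin

lemma sym2_pdeg:
  assumes "v \<in> V"
  shows "(\<lambda>X. sym2 n i X v) \<in> pdeg V (\<lambda>_. 1) (int (w2 i v))"
proof -
  obtain k r where v: "v = (k, r)" "k \<in> M" "r \<in> {1..n}" using assms V_def by auto
  have a: "(i, r) \<in> V" "(Suc i, r) \<in> V" "(Suc i, prv n r) \<in> V" "(k, r) \<in> V"
    using v iM n1 by (auto simp: V_def prv_def)
  have x: "(\<lambda>X. X u) \<in> pdeg V (\<lambda>_. 1) 1" if "u \<in> V" for u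
    using that by (intro pdeg_var) auto
  consider "k = i" | "k = Suc i" | "k \<noteq> i" "k \<noteq> Suc i" by blast
  then show ?thesis
  proof cases
    case 1
    then show ?thesis using pdeg_add[OF x[OF a(1)] x[OF a(3)]] v by (simp add: sym2_def w2_def)
  next
    case 2
    then show ?thesis using pdeg_mult[OF x[OF a(1)] x[OF a(2)]] v by (simp add: sym2_def w2_def)
  next
    case 3
    then show ?thesis using x[OF a(4)] v by (simp add: sym2_def w2_def)
  qed
qed

lemma comp_sym2_pdeg:
  "P \<in> pdeg V (w2 i) d \<Longrightarrow> (\<lambda>X. P (sym2 n i X)) \<in> pdeg V (\<lambda>_. 1) d"
  by (erule pdeg_comp[OF _ sym2_pdeg])

lemma comp_psi_rfun:
  assumes f: "f \<in> pfun V" and N: "1 \<le> N" "N \<le> n"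
  shows "rfun (\<lambda>X. \<Prod>r\<in>{1..<N}. rho i N X r) (\<lambda>X. f (psi n i N X))"
proof (rule rfun_comp[OF f])
  show "(\<lambda>X. \<Prod>r = 1..<N. rho i N X r) \<in> pfun UNIV"
    by (intro pfun_prod rho_pfun)
  fix v assume "v \<in> V"
  then obtain k r where v: "v = (k, r)" "k \<in> M" "r \<in> {1..n}" using V_def by auto
  have dv: "rfun (\<lambda>X. \<Prod>r\<in>{1..<N}. rho i N X r) (\<lambda>X. p X / rho i N X s)"
    if "p \<in> pfun UNIV" "1 \<le> s" for p s
    using that by (intro rfun_divide_factor rho_pfun) (auto simp: rho_end)
  show "rfun (\<lambda>X. \<Prod>r = 1..<N. rho i N X r) (\<lambda>X. psi n i N X v)"
    unfolding psi_def using v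
    by (cases "k = i"; cases "k = Suc i"; cases "r < N"; cases "r < n")
      (auto intro!: dv[unfolded One_nat_def] pfun_intros rho_pfun intro: rfun_pfun[OF pconst] rfun_pfun[OF pvar[of _ UNIV]])
qed

lemma comp_psi'_rfun:
  assumes f: "f \<in> pfun V" and N: "1 \<le> N" "N \<le> n"
  shows "rfun (\<lambda>X. \<Prod>r\<in>{1..<N}. sig n i X r) (\<lambda>X. f (psi' n i N X))"
proof (rule rfun_comp[OF f])
  show "(\<lambda>X. \<Prod>r = 1..<N. sig n i X r) \<in> pfun UNIV"
    by (intro pfun_prod sig_pfun)
  fix v assume "v \<in> V"
  then obtain k r where v: "v = (k, r)" "k \<in> M" "r \<in> {1..n}" using V_def by auto
  have dv: "rfun (\<lambda>X. \<Prod>r\<in>{1..<N}. sig n i X r) (\<lambda>X. p X / sig n i X s)"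
    if "p \<in> pfun UNIV" "s < N" for p s
    by (rule rfun_divide_factor[OF that(1) sig_pfun]) (use that in \<open>cases s; auto\<close>)
  show "rfun (\<lambda>X. \<Prod>r = 1..<N. sig n i X r) (\<lambda>X. psi' n i N X v)"
    unfolding psi'_def using v N
    by (cases "k = i"; cases "k = Suc i"; cases "r < N"; cases "r = N")
      (auto intro!: dv[unfolded One_nat_def] pfun_intros sig_pfun intro: rfun_pfun[OF pconst] rfun_pfun[OF pvar[of _ UNIV]])
qed

text \<open>The only term of \<open>rho i (Suc N) X r\<close> without the factor x_(N+1) contains
  y_N.\<close>

lemma rho_restrict:
  assumes "X (Suc i, N) = 0" "r \<le> N"
  shows "rho i (Suc N) X r = X (i, Suc N) * rho i N X r"
  using assms(2)
proof (induction "N - r" arbitrary: r)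
  case 0
  then have "r = N" by simp
  moreover have "{N<..Suc N} = {Suc N}" by auto
  ultimately show ?case using assms(1) by (simp add: rho_step rho_end)
next
  case (Suc k)
  then have "rho i (Suc N) X (Suc r) = X (i, Suc N) * rho i N X (Suc r)" "r < N" by auto
  moreover have "{r<..Suc N} = insert (Suc N) {r<..N}" using Suc by auto
  ultimately show ?case by (simp add: rho_step algebra_simps)
qed

text \<open>On the smaller subspaces the formulas for \<open>Suc N\<close> and N agree wherever one
  extra factor is nonzero: x_(N+1) for \<open>psi\<close>, by \<open>rho_restrict\<close>, and sig_N
  = y_n y_1 ... y_(N-1) for \<open>psi'\<close>. Density removes this condition.\<close>

lemma compat_restrict:
  assumes c: "compat_pair n i (Suc N) f1 f2" and N: "1 \<le> N" "Suc N \<le> n"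
    and f: "f1 \<in> pfun V" "f2 \<in> pfun V"
  shows "compat_pair n i N f1 f2"
  unfolding compat_pair_def
proof (intro conjI ballI impI)
  fix X assume X: "X \<in> zs (tail n (Suc i) N)" and nz: "\<forall>r\<in>{1..<N}. rho i N X r \<noteq> 0"
  show "f2 X = f1 (psi n i N X)"
  proof (rule rfun_eq_dense[where q="\<lambda>X. \<Prod>r\<in>{1..<N}. rho i N X r"
        and F=f2 and G="\<lambda>X. f1 (psi n i N X)" and g="\<lambda>X. X (i, Suc N)" and B="tail n (Suc i) N" and b="off (tail n (Suc i) N)"])
    show "(\<lambda>X. \<Prod>r = 1..<N. rho i N X r) \<in> pfun UNIV"
      by (intro pfun_prod rho_pfun)
    show "rfun (\<lambda>X. \<Prod>r = 1..<N. rho i N X r) f2"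
      by (rule rfun_pfun[OF f(2)])
    show "rfun (\<lambda>X. \<Prod>r = 1..<N. rho i N X r) (\<lambda>X. f1 (psi n i N X))"
      using comp_psi_rfun[OF f(1)] N by simp
    fix X assume X: "X \<in> zs (tail n (Suc i) N)"
      and q: "(\<Prod>r = 1..<N. rho i N X r) \<noteq> 0" and x: "X (i, Suc N) \<noteq> 0"
    have y0: "X (Suc i, N) = 0" using X N by (auto simp: zs_def)
    have rr: "rho i (Suc N) X r = X (i, Suc N) * rho i N X r" if "r \<le> N" for r
      by (rule rho_restrict[of X N r, OF y0 that])
    have nz: "rho i N X r \<noteq> 0" if "1 \<le> r" for r
      using q that by (cases "r < N") (auto simp: rho_end)
    have "X \<in> zs (tail n (Suc i) (Suc N))" using X by (auto simp: zs_def)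
    moreover have "rho i (Suc N) X r \<noteq> 0" if "r \<in> {1..<Suc N}" for r
      using rr[of r] nz[of r] x that by simp
    ultimately have "f2 X = f1 (psi n i (Suc N) X)"
      using c unfolding compat_pair_def by blast
    also have "\<dots> = f1 (psi n i N X)"
    proof (rule pfun_cong[OF f(1)])
      fix v assume "v \<in> V"
      then obtain k r where v: "v = (k, r)" "k \<in> M" "r \<in> {1..n}" using V_def by auto
      consider "r < N" | "r = N" | "N < r" "r < n" | "N < r" "r = n" using v by fastforce
      then show "psi n i (Suc N) X v = psi n i N X v"
      proof cases
        case 1
        then have "rho i (Suc N) X r = X (i, Suc N) * rho i N X r"
          "rho i (Suc N) X (Suc r) = X (i, Suc N) * rho i N X (Suc r)"
          using rr[of r] rr[of "Suc r"] by auto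
        then show ?thesis using 1 v(1) x by (simp add: psi_def)
      next
        case 2
        then show ?thesis using v x N y0 rr[of N] by (simp add: psi_def rho_end)
      next
        case 3
        then show ?thesis using v by (auto simp: psi_def)
      next
        case 4
        then show ?thesis using v x N rr[of 1] by (simp add: psi_def)
      qed
    qed
    finally show "f2 X = f1 (psi n i N X)" .
  next
    show "(\<lambda>X. X (i, Suc N)) \<in> pfun UNIV" by (rule pvar) simp
  qed (use X nz in \<open>simp_all add: off_in_zs off_def\<close>)
next
  fix X assume X: "X \<in> zs (tail n i N)" and nz: "\<forall>r\<in>{1..<N}. sig n i X r \<noteq> 0"
  obtain p where p: "N = Suc p" using N by (cases N) auto
  let ?Y = "\<lambda>X. X (Suc i, n) * (\<Prod>s\<in>{1..p}. X (Suc i, s))"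
  show "f1 X = f2 (psi' n i N X)"
  proof (rule rfun_eq_dense[where q="\<lambda>X. \<Prod>r\<in>{1..<N}. sig n i X r"
        and F=f1 and G="\<lambda>X. f2 (psi' n i N X)" and g="?Y" and B="tail n i N" and b="off (tail n i N)"])
    show "(\<lambda>X. \<Prod>r = 1..<N. sig n i X r) \<in> pfun UNIV"
      by (intro pfun_prod sig_pfun)
    show "?Y \<in> pfun UNIV" by (auto intro!: pfun_intros)
    show "rfun (\<lambda>X. \<Prod>r = 1..<N. sig n i X r) f1"
      by (rule rfun_pfun[OF f(1)])
    show "rfun (\<lambda>X. \<Prod>r = 1..<N. sig n i X r) (\<lambda>X. f2 (psi' n i N X))"
      using comp_psi'_rfun[OF f(2)] N by simp
    fix X assume X: "X \<in> zs (tail n i N)"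
      and q: "(\<Prod>r = 1..<N. sig n i X r) \<noteq> 0" and x: "?Y X \<noteq> 0"
    have x0: "X (i, N) = 0" using X N by (auto simp: zs_def)
    then have sN: "sig n i X N = ?Y X" unfolding p by simp
    have nz: "sig n i X r \<noteq> 0" if r: "r \<le> N" for r
    proof -
      consider "r = 0" | "r \<in> {1..<N}" | "r = N" using r by fastforce
      then show ?thesis
      proof cases
        case 2
        then show ?thesis using q by auto
      qed (use x sN in simp_all)
    qed
    have "X \<in> zs (tail n i (Suc N))" using X by (auto simp: zs_def)
    moreover have "sig n i X r \<noteq> 0" if "r \<in> {1..<Suc N}" for r
      using nz[of r] that by simp
    ultimately have "f1 X = f2 (psi' n i (Suc N) X)"
      using c unfolding compat_pair_def by blast
    also have "\<dots> = f2 (psi' n i N X)"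
    proof (rule pfun_cong[OF f(2)])
      fix v assume "v \<in> V"
      then obtain k r where v: "v = (k, r)" "k \<in> M" "r \<in> {1..n}" using V_def by auto
      consider "r < N" | "r = N" | "r = Suc N" | "Suc N < r" using v by fastforce
      then show "psi' n i (Suc N) X v = psi' n i N X v"
      proof cases
        case 2
        then show ?thesis using v(1) x0 sN by (simp add: psi'_def p)
      next
        case 3
        have "(\<Prod>s = 1..N. X (Suc i, s)) = (\<Prod>s\<in>{1..p}. X (Suc i, s)) * X (Suc i, N)"
          unfolding p by simp
        then have "X (Suc i, n) * (\<Prod>s = 1..N. X (Suc i, s)) = X (Suc i, N) * ?Y X"
          by (simp add: algebra_simps)
        then show ?thesis using 3 v(1) x sN by (simp add: psi'_def)
      qed (use v in \<open>auto simp: psi'_def\<close>)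
    qed
    finally show "f1 X = f2 (psi' n i N X)" .
  qed (use X nz N in \<open>simp_all add: off_in_zs off_def\<close>)
qed

text \<open>At \<open>Suc N\<close>, the entry of \<open>psi\<close> in row \<open>i\<close> and
  column N keeps the factor x_N, so points with x_N = 0 are sent to where \<open>f1\<close>
  vanishes.\<close>

lemma vanish_psi:
  assumes N: "1 \<le> N" "N < n" and f: "f1 \<in> pfun V" "f2 \<in> pfun V"
    and c: "compat_pair n i (Suc N) f1 f2" and v: "\<And>X. X \<in> zs (tail n i N) \<Longrightarrow> f1 X = 0"
    and X: "X \<in> zs (insert (i, N) (tail n (Suc i) (Suc N)))"
  shows "f2 X = 0"
proof (rule pfun_eq_0_dense[OF f(2) _ _ _ _ X])
  let ?B = "insert (i, N) (tail n (Suc i) (Suc N))"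
  \<comment> \<open>Row \<open>i\<close> is zero and y_1, ..., y_N are one, so only the pure y-term
    survives in each \<open>rho\<close>.\<close>
  let ?b = "off (?B \<union> {i} \<times> UNIV)"
  show "(\<lambda>X. \<Prod>r = 1..<Suc N. rho i (Suc N) X r) \<in> pfun UNIV"
    by (intro pfun_prod rho_pfun)
  show "?b \<in> zs ?B" by (auto simp: zs_def off_def)
  have "rho i (Suc N) ?b r = 1" for r
  proof (induction "Suc N - r" arbitrary: r)
    case 0
    then show ?case by (simp add: rho_end)
  next
    case (Suc k)
    then have r: "r < Suc N" "rho i (Suc N) ?b (Suc r) = 1" by auto
    then have "?b (Suc i, r) = 1" by (simp add: off_def)
    moreover have "(\<Prod>s\<in>{r<..Suc N}. ?b (i, s)) = 0"
      using r(1) by (intro prod_zero bexI[of _ "Suc N"]) (auto simp: off_def)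
    ultimately show ?case using r by (simp add: rho_step)
  qed
  then show "(\<Prod>r = 1..<Suc N. rho i (Suc N) ?b r) \<noteq> 0" by simp
  fix X assume X: "X \<in> zs ?B"
  show "f2 X * (\<Prod>r = 1..<Suc N. rho i (Suc N) X r) = 0"
  proof (cases "\<forall>r\<in>{1..<Suc N}. rho i (Suc N) X r \<noteq> 0")
    case True
    have "X \<in> zs (tail n (Suc i) (Suc N))" using X by (auto simp: zs_def)
    then have "f2 X = f1 (psi n i (Suc N) X)" using c True unfolding compat_pair_def by blast
    also have "\<dots> = 0"
    proof (rule v)
      have "X (i, N) = 0" using X by (simp add: zs_def)
      then show "psi n i (Suc N) X \<in> zs (tail n i N)"
        by (auto simp: zs_def psi_def less_Suc_eq)
    qed
    finally show ?thesis by simp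
  next
    case False
    then have "(\<Prod>r = 1..<Suc N. rho i (Suc N) X r) = 0" by (intro prod_zero) auto
    then show ?thesis by simp
  qed
qed

text \<open>The mirror image of \<open>vanish_psi\<close>: y_N survives as a factor in row
  \<open>Suc i\<close>. The test point now has row \<open>Suc i\<close> zero and x_1 = ... = x_N =
  1, which makes every \<open>sig\<close> up to N equal to 1.\<close>

lemma vanish_psi':
  assumes N: "1 \<le> N" "N < n" and f: "f1 \<in> pfun V" "f2 \<in> pfun V"
    and c: "compat_pair n i (Suc N) f1 f2" and v: "\<And>X. X \<in> zs (tail n (Suc i) N) \<Longrightarrow> f2 X = 0"
    and X: "X \<in> zs (insert (Suc i, N) (tail n i (Suc N)))"
  shows "f1 X = 0"
proof (rule pfun_eq_0_dense[OF f(1) _ _ _ _ X])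
  let ?B = "insert (Suc i, N) (tail n i (Suc N))"
  let ?b = "off (?B \<union> {Suc i} \<times> UNIV)"
  show "(\<lambda>X. \<Prod>r = 1..<Suc N. sig n i X r) \<in> pfun UNIV"
    by (intro pfun_prod sig_pfun)
  show "?b \<in> zs ?B" by (auto simp: zs_def off_def)
  have "r \<le> N \<Longrightarrow> sig n i ?b r = 1" for r
    by (induction r) (auto simp: off_def)
  then show "(\<Prod>r = 1..<Suc N. sig n i ?b r) \<noteq> 0" by simp
  fix X assume X: "X \<in> zs ?B"
  show "f1 X * (\<Prod>r = 1..<Suc N. sig n i X r) = 0"
  proof (cases "\<forall>r\<in>{1..<Suc N}. sig n i X r \<noteq> 0")
    case True
    have "X \<in> zs (tail n i (Suc N))" using X by (auto simp: zs_def)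
    then have "f1 X = f2 (psi' n i (Suc N) X)" using c True unfolding compat_pair_def by blast
    also have "\<dots> = 0"
    proof (rule v)
      have "X (Suc i, N) = 0" using X by (simp add: zs_def)
      then show "psi' n i (Suc N) X \<in> zs (tail n (Suc i) N)"
        by (auto simp: zs_def psi'_def less_Suc_eq)
    qed
    finally show ?thesis by simp
  next
    case False
    then have "(\<Prod>r = 1..<Suc N. sig n i X r) = 0" by (intro prod_zero) auto
    then show ?thesis by simp
  qed
qed

lemma pdeg_divide_pair:
  assumes "f \<in> pdeg V (\<lambda>_. 1) d" "r \<in> {1..n}" "(i, r) \<notin> B" "(Suc i, r) \<notin> B"
    "\<And>X. X \<in> zs (insert (i, r) B) \<Longrightarrow> f X = 0" "\<And>X. X \<in> zs (insert (Suc i, r) B) \<Longrightarrow> f X = 0"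
  obtains h where "h \<in> pdeg V (\<lambda>_. 1) (d - 2)"
    "\<And>X. X \<in> zs B \<Longrightarrow> f X = X (i, r) * X (Suc i, r) * h X"
proof -
  have "\<exists>h\<in>pdeg V (\<lambda>_. 1) (d - int (\<Sum>v\<in>{(i, r), (Suc i, r)}. 1)).
      \<forall>X\<in>zs B. f X = (\<Prod>v\<in>{(i, r), (Suc i, r)}. X v) * h X"
    using assms iM by (intro pdeg_divide_vars) (auto simp: V_def)
  then show ?thesis using that by (auto simp: mult.assoc)
qed

lemma sym2_comp_cong:
  assumes "P \<in> pfun V" "\<And>k r. r \<in> {1..n} \<Longrightarrow> sym2 n i X (k, r) = sym2 n i Y (k, r)"
  shows "P (sym2 n i X) = P (sym2 n i Y)"
proof (rule pfun_cong[OF assms(1)])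
  fix v assume "v \<in> V"
  then obtain k r where "v = (k, r)" "r \<in> {1..n}" unfolding V_def by blast
  then show "sym2 n i X v = sym2 n i Y v" using assms(2) by simp
qed

text \<open>Induction on N, and for each N descent on the degree. A single \<open>P\<close> has to
  serve both functions; this is possible because \<open>psi\<close> and \<open>psi'\<close> preserve
  the two-row invariants.\<close>

lemma compat_imp_sym2:
  assumes "1 \<le> N" "N \<le> n" "f1 \<in> pdeg V (\<lambda>_. 1) d" "f2 \<in> pdeg V (\<lambda>_. 1) d" "compat_pair n i N f1 f2"
  shows "\<exists>P\<in>pdeg V (w2 i) d.
    (\<forall>X\<in>zs (tail n (Suc i) N). f2 X = P (sym2 n i X)) \<and> (\<forall>X\<in>zs (tail n i N). f1 X = P (sym2 n i X))"
  using assms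
proof (induction N arbitrary: d f1 f2 rule: nat_induct_at_least)
  case base
  \<comment> \<open>With y = 0 the map \<open>sym2\<close> only copies the x-row, so
    \<open>f2\<close> read with a zero row \<open>Suc i\<close> is the polynomial. It also serves
    \<open>f1\<close>, through \<open>psi'\<close>, which here is a cyclic shift.\<close>
  define P where "P = (\<lambda>Y::mat. f2 (\<lambda>(k, r). if k = Suc i then 0 else Y (k, r)))"
  have P: "P \<in> pdeg V (w2 i) d"
    unfolding P_def
  proof (rule pdeg_comp[OF base(3)])
    fix v assume v: "v \<in> V"
    obtain k r where kr: "v = (k, r)" by (cases v)
    show "(\<lambda>X. (\<lambda>(k, r). if k = Suc i then 0 else X (k, r)) v) \<in> pdeg V (w2 i) (int 1)"
      using v unfolding kr
      by (cases "k = Suc i") (simp_all add: w2_def pdeg_zero pdeg_var)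
  qed
  have a: "f2 X = P (sym2 n i X)" if X: "X \<in> zs (tail n (Suc i) 1)" for X
    unfolding P_def
  proof (rule pfun_cong[OF pdeg_imp_pfun[OF base(3)]])
    fix v assume "v \<in> V"
    then obtain k r where v: "v = (k, r)" "r \<in> {1..n}" unfolding V_def by blast
    then have "prv n r \<in> {1..n}" by (auto simp: prv_def)
    then have "X (Suc i, prv n r) = 0" "X (Suc i, r) = 0" using X v by (auto simp: zs_def)
    then show "X v = (case v of (k, r) \<Rightarrow> if k = Suc i then 0 else sym2 n i X (k, r))"
      using v(1) by (simp add: sym2_def)
  qed
  have "f1 X = P (sym2 n i X)" if X: "X \<in> zs (tail n i 1)" for X
  proof -
    have "f1 X = f2 (psi' n i 1 X)"
      using base(4) X unfolding compat_pair_def by auto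
    also have "\<dots> = P (sym2 n i (psi' n i 1 X))"
      by (rule a[OF psi'_in_zs])
    also have "\<dots> = P (sym2 n i X)"
      by (rule sym2_comp_cong[OF pdeg_imp_pfun[OF P]], rule sym2_psi') (use X n1 in auto)
    finally show ?thesis .
  qed
  then show ?case using P a by auto
next
  case (Suc N)
  then have N: "1 \<le> N" "N < n" by auto
  show ?case using Suc.prems(2-4)
  proof (induction "nat (d + 1)" arbitrary: d f1 f2 rule: less_induct)
    case less
    note pf = pdeg_imp_pfun
    show ?case
    proof (cases "d < 0")
      case True
      then have "f1 X = 0" "f2 X = 0" for X
        using pdeg_neg[OF less.prems(1)] pdeg_neg[OF less.prems(2)] by auto
      then show ?thesis by (intro bexI[of _ "\<lambda>_. 0"]) (auto intro: pdeg_zero)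
    next
      case False
      have "compat_pair n i N f1 f2"
        by (rule compat_restrict[OF less.prems(3)]) (use less.prems N in \<open>auto intro: pf\<close>)
      then obtain P0 where P0: "P0 \<in> pdeg V (w2 i) d"
        and P0f2: "\<And>X. X \<in> zs (tail n (Suc i) N) \<Longrightarrow> f2 X = P0 (sym2 n i X)"
        and P0f1: "\<And>X. X \<in> zs (tail n i N) \<Longrightarrow> f1 X = P0 (sym2 n i X)"
        using Suc.IH[of f1 d f2] less.prems N by auto
      define g1 where "g1 = (\<lambda>X. f1 X - P0 (sym2 n i X))"
      define g2 where "g2 = (\<lambda>X. f2 X - P0 (sym2 n i X))"
      have g: "g1 \<in> pdeg V (\<lambda>_. 1) d" "g2 \<in> pdeg V (\<lambda>_. 1) d"
        unfolding g1_def g2_def by (intro pdeg_diff less.prems comp_sym2_pdeg[OF P0])+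
      have P0psi: "P0 (sym2 n i (psi n i (Suc N) X)) = P0 (sym2 n i X)"
        if "X \<in> zs (tail n (Suc i) (Suc N))" "\<forall>r\<in>{1..<Suc N}. rho i (Suc N) X r \<noteq> 0" for X
        by (rule sym2_comp_cong[OF pf[OF P0]], rule sym2_psi) (use that N in auto)
      have P0psi': "P0 (sym2 n i (psi' n i (Suc N) X)) = P0 (sym2 n i X)"
        if "X \<in> zs (tail n i (Suc N))" "\<forall>r\<in>{1..<Suc N}. sig n i X r \<noteq> 0" for X
        by (rule sym2_comp_cong[OF pf[OF P0]], rule sym2_psi') (use that N in auto)
      have cg: "compat_pair n i (Suc N) g1 g2"
        using less.prems(3) P0psi P0psi' unfolding compat_pair_def g1_def g2_def by simp
      have ins: "insert (k, N) (tail n k (Suc N)) = tail n k N" for k :: nat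
        using N by auto
      have v2: "g2 X = 0" if "X \<in> zs (tail n (Suc i) N)" for X
        using P0f2[OF that] by (simp add: g2_def)
      have v1: "g1 X = 0" if "X \<in> zs (tail n i N)" for X
        using P0f1[OF that] by (simp add: g1_def)
      have Nn: "N \<in> {1..n}" using N by simp
      \<comment> \<open>\<open>g2\<close> vanishes at y_N = 0 by the choice of \<open>P0\<close>,
        and at x_N = 0 because \<open>vanish_psi\<close> transports the vanishing of
        \<open>g1\<close>. The roles are exchanged for \<open>h1\<close>.\<close>
      obtain h2 where h2: "h2 \<in> pdeg V (\<lambda>_. 1) (d - 2)"
        and g2h: "\<And>X. X \<in> zs (tail n (Suc i) (Suc N)) \<Longrightarrow> g2 X = X (i, N) * X (Suc i, N) * h2 X"
        by (rule pdeg_divide_pair[OF g(2) Nn, of "tail n (Suc i) (Suc N)"])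
          (use v2 vanish_psi[OF N pf[OF g(1)] pf[OF g(2)] cg v1] ins in auto)
      obtain h1 where h1: "h1 \<in> pdeg V (\<lambda>_. 1) (d - 2)"
        and g1h: "\<And>X. X \<in> zs (tail n i (Suc N)) \<Longrightarrow> g1 X = X (i, N) * X (Suc i, N) * h1 X"
        by (rule pdeg_divide_pair[OF g(1) Nn, of "tail n i (Suc N)"])
          (use v1 vanish_psi'[OF N pf[OF g(1)] pf[OF g(2)] cg v2] ins in auto)
      let ?p = "\<lambda>X::mat. X (i, N) * X (Suc i, N)"
      have p: "?p \<in> pfun UNIV" by (auto intro!: pfun_intros)
      \<comment> \<open>Both \<open>psi\<close> and \<open>psi'\<close> preserve x_N y_N. This
        factor cancels where it is nonzero, and density gives the relations between the
        quotients.\<close>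
      have "compat_pair n i (Suc N) h1 h2"
        unfolding compat_pair_def
      proof (intro conjI ballI impI)
        fix X assume X: "X \<in> zs (tail n (Suc i) (Suc N))"
          and nz: "\<forall>r\<in>{1..<Suc N}. rho i (Suc N) X r \<noteq> 0"
        show "h2 X = h1 (psi n i (Suc N) X)"
        proof (rule rfun_eq_dense[where q="\<lambda>X. \<Prod>r\<in>{1..<Suc N}. rho i (Suc N) X r"
              and F=h2 and G="\<lambda>X. h1 (psi n i (Suc N) X)" and g="?p"
              and B="tail n (Suc i) (Suc N)" and b="off (tail n (Suc i) (Suc N))"])
          show "(\<lambda>X. \<Prod>r = 1..<Suc N. rho i (Suc N) X r) \<in> pfun UNIV"
            by (intro pfun_prod rho_pfun)
          show "rfun (\<lambda>X. \<Prod>r = 1..<Suc N. rho i (Suc N) X r) (\<lambda>X. h1 (psi n i (Suc N) X))"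
            using N by (intro comp_psi_rfun[OF pf[OF h1]]) auto
          fix X assume X: "X \<in> zs (tail n (Suc i) (Suc N))"
            and q: "(\<Prod>r = 1..<Suc N. rho i (Suc N) X r) \<noteq> 0" and px: "?p X \<noteq> 0"
          have nz: "\<forall>r\<in>{1..<Suc N}. rho i (Suc N) X r \<noteq> 0"
            using q by (metis (no_types, lifting) finite_atLeastLessThan prod_zero)
          have "sym2 n i (psi n i (Suc N) X) (Suc i, N) = sym2 n i X (Suc i, N)"
            by (rule sym2_psi) (use X nz N in auto)
          then have "?p (psi n i (Suc N) X) = ?p X" by (simp add: sym2_def)
          moreover have "g2 X = g1 (psi n i (Suc N) X)"
            using cg X nz unfolding compat_pair_def by blast
          ultimately have "?p X * h2 X = ?p X * h1 (psi n i (Suc N) X)"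
            using g2h[OF X] g1h[OF psi_in_zs, of X] by simp
          then show "h2 X = h1 (psi n i (Suc N) X)" using px by simp
        qed (use X nz p N rfun_pfun[OF pf[OF h2]] in \<open>simp_all add: off_in_zs off_def\<close>)
      next
        fix X assume X: "X \<in> zs (tail n i (Suc N))"
          and nz: "\<forall>r\<in>{1..<Suc N}. sig n i X r \<noteq> 0"
        show "h1 X = h2 (psi' n i (Suc N) X)"
        proof (rule rfun_eq_dense[where q="\<lambda>X. \<Prod>r\<in>{1..<Suc N}. sig n i X r"
              and F=h1 and G="\<lambda>X. h2 (psi' n i (Suc N) X)" and g="?p"
              and B="tail n i (Suc N)" and b="off (tail n i (Suc N))"])
          show "(\<lambda>X. \<Prod>r = 1..<Suc N. sig n i X r) \<in> pfun UNIV"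
            by (intro pfun_prod sig_pfun)
          show "rfun (\<lambda>X. \<Prod>r = 1..<Suc N. sig n i X r) (\<lambda>X. h2 (psi' n i (Suc N) X))"
            using N by (intro comp_psi'_rfun[OF pf[OF h2]]) auto
          fix X assume X: "X \<in> zs (tail n i (Suc N))"
            and q: "(\<Prod>r = 1..<Suc N. sig n i X r) \<noteq> 0" and px: "?p X \<noteq> 0"
          have nz: "\<forall>r\<in>{1..<Suc N}. sig n i X r \<noteq> 0"
            using q by (metis (no_types, lifting) finite_atLeastLessThan prod_zero)
          have "sym2 n i (psi' n i (Suc N) X) (Suc i, N) = sym2 n i X (Suc i, N)"
            by (rule sym2_psi') (use X nz N in auto)
          then have "?p (psi' n i (Suc N) X) = ?p X" by (simp add: sym2_def)
          moreover have "g1 X = g2 (psi' n i (Suc N) X)"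
            using cg X nz unfolding compat_pair_def by blast
          ultimately have "?p X * h1 X = ?p X * h2 (psi' n i (Suc N) X)"
            using g1h[OF X] g2h[OF psi'_in_zs, of X] by simp
          then show "h1 X = h2 (psi' n i (Suc N) X)" using px by simp
        qed (use X nz p N rfun_pfun[OF pf[OF h1]] in \<open>simp_all add: off_in_zs off_def\<close>)
      qed
      then obtain P1 where P1: "P1 \<in> pdeg V (w2 i) (d - 2)"
        and P1h2: "\<And>X. X \<in> zs (tail n (Suc i) (Suc N)) \<Longrightarrow> h2 X = P1 (sym2 n i X)"
        and P1h1: "\<And>X. X \<in> zs (tail n i (Suc N)) \<Longrightarrow> h1 X = P1 (sym2 n i X)"
        using less.hyps[of "d - 2" h1 h2] h1 h2 False by auto
      \<comment> \<open>The variable at \<open>(Suc i, N)\<close> stands for the invariant x_N y_N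
        that was divided out.\<close>
      define P where "P = (\<lambda>Y. P0 Y + Y (Suc i, N) * P1 Y)"
      have "(\<lambda>Y::mat. Y (Suc i, N)) \<in> pdeg V (w2 i) 2"
        using iM Nn by (intro pdeg_var) (auto simp: V_def w2_def)
      then have "P \<in> pdeg V (w2 i) d"
        unfolding P_def by (intro pdeg_add[OF P0] pdeg_mult[OF _ P1]) auto
      moreover have sN: "sym2 n i X (Suc i, N) = ?p X" for X by (simp add: sym2_def)
      have "f2 X = P (sym2 n i X)" if X: "X \<in> zs (tail n (Suc i) (Suc N))" for X
        using g2h[OF X] P1h2[OF X] by (simp add: g2_def P_def sN algebra_simps)
      moreover have "f1 X = P (sym2 n i X)" if X: "X \<in> zs (tail n i (Suc N))" for X
        using g1h[OF X] P1h1[OF X] by (simp add: g1_def P_def sN algebra_simps)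
      ultimately show ?thesis by blast
    qed
  qed
qed

end

section \<open>The sums \<open>kappa\<close> and the form of \<open>Rop\<close> on coordinate
  hyperplanes\<close>

lemma idx_of_nat: "1 \<le> r \<Longrightarrow> r \<le> n \<Longrightarrow> idx n (int r) = r"
proof -
  assume "1 \<le> r" "r \<le> n"
  then have "(int r - 1) mod int n = int r - 1" by (intro mod_pos_pos_trivial) auto
  then show ?thesis using \<open>1 \<le> r\<close> by (simp add: idx_def)
qed

lemma idx_in: "1 \<le> n \<Longrightarrow> idx n j \<in> {1..n}"
proof -
  assume "1 \<le> n"
  then have "(j - 1) mod int n < int n" by simp
  then have "nat ((j - 1) mod int n) < n" using \<open>1 \<le> n\<close> by linarith
  then show ?thesis by (simp add: idx_def)
qed

lemma idx_add_n: "idx n (j + int n) = idx n j"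
proof -
  have "j + int n - 1 = j - 1 + int n" by simp
  then show ?thesis unfolding idx_def by (simp only: mod_add_self2)
qed

lemma kappa_add_n: "kappa n x y (r + n) = kappa n x y r"
proof -
  have "idx n (int (r + n) + int t) = idx n (int r + int t)" for t
    using idx_add_n[of n "int r + int t"] by (simp add: algebra_simps)
  then show ?thesis by (simp add: kappa_def)
qed

lemma kappa_Suc_n: "kappa n x y (Suc n) = kappa n x y 1"
  using kappa_add_n[of n x y 1] by simp

text \<open>A product over a full period does not depend on the starting column; with the offset
  \<open>Suc r\<close> the case r = 0 starts at column 1.\<close>

lemma prod_idx:
  assumes "1 \<le> n"
  shows "(\<Prod>t<n. x (idx n (int (Suc r) + int t))) = (\<Prod>j\<in>{1..n}. x j :: complex)"
proof (induction r)
  case 0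
  have "(\<Prod>t<n. x (idx n (int (Suc 0) + int t))) = (\<Prod>t<n. x (Suc t))"
  proof (rule prod.cong[OF refl])
    fix t assume "t \<in> {..<n}"
    then show "x (idx n (int (Suc 0) + int t)) = x (Suc t)"
      using idx_of_nat[of "Suc t" n] by (simp add: algebra_simps)
  qed
  then show ?case by (simp add: prod.atLeast1_atMost_eq)
next
  case (Suc r)
  obtain p where p: "n = Suc p" using assms by (cases n) auto
  let ?a = "\<lambda>t. x (idx n (int (Suc r) + int t))"
  have "?a n = ?a 0"
    using idx_add_n[of n "int (Suc r)"] by (simp add: algebra_simps)
  moreover have "x (idx n (int (Suc (Suc r)) + int t)) = ?a (Suc t)" for t
    by (simp add: algebra_simps)
  ultimately have "(\<Prod>t<n. x (idx n (int (Suc (Suc r)) + int t))) = ?a 0 * (\<Prod>t<p. ?a (Suc t))"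
    unfolding p prod.lessThan_Suc by (simp add: mult.commute)
  also have "\<dots> = (\<Prod>t<n. ?a t)"
    unfolding p by (rule prod.lessThan_Suc_shift[symmetric])
  finally show ?case using Suc by simp
qed

text \<open>With T_k = y_r ... y_(r+k-1) x_(r+k+1) ... x_(r+n), the terms of x_r kappa_r are T_0,
  ..., T_(n-1) and those of y_r kappa_(r+1) are T_1, ..., T_n. Only the end terms differ, and these
  are the full products of the two rows.\<close>

lemma kappa_relation:
  assumes r: "1 \<le> r" "r \<le> n"
  shows "y r * kappa n x y (Suc r) + (\<Prod>j\<in>{1..n}. x j) = x r * kappa n x y r + (\<Prod>j\<in>{1..n}. y j)"
proof -
  obtain p where p: "r = Suc p" using r by (cases r) auto
  have n: "1 \<le> n" using r by simp
  define a where "a t = x (idx n (int r + int t))" for t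
  define b where "b t = y (idx n (int r + int t))" for t
  define T where "T k = (\<Prod>t<k. b t) * (\<Prod>t\<in>{Suc k..n}. a t)" for k
  have an: "a n = a 0"
    using idx_add_n[of n "int r"] by (simp add: a_def algebra_simps)
  have a0: "a 0 = x r" "b 0 = y r" using idx_of_nat[OF r] by (simp_all add: a_def b_def)
  have "x r * kappa n x y r = (\<Sum>k<n. T k)"
    unfolding kappa_def sum_distrib_left
  proof (rule sum.cong[OF refl])
    fix k assume k: "k \<in> {..<n}"
    then have "{Suc k..n} = insert n {k + 1..n - 1}" "n \<notin> {k + 1..n - 1}" by auto
    then have "(\<Prod>t\<in>{Suc k..n}. a t) = a n * (\<Prod>t\<in>{k + 1..n - 1}. a t)" by simp
    then show "x r * ((\<Prod>t<k. y (idx n (int r + int t))) * (\<Prod>t = k + 1..n - 1. x (idx n (int r + int t)))) = T k"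
      unfolding T_def an a0 by (simp add: a_def b_def)
  qed
  moreover have "y r * kappa n x y (Suc r) = (\<Sum>k<n. T (Suc k))"
    unfolding kappa_def sum_distrib_left
  proof (rule sum.cong[OF refl])
    fix k assume k: "k \<in> {..<n}"
    have s: "idx n (int (Suc r) + int t) = idx n (int r + int (Suc t))" for t
      by (simp add: algebra_simps)
    have "(\<Prod>t<Suc k. b t) = y r * (\<Prod>t<k. y (idx n (int (Suc r) + int t)))"
      unfolding prod.lessThan_Suc_shift a0 s by (simp add: b_def)
    moreover have "(\<Prod>t = k + 1..n - 1. x (idx n (int (Suc r) + int t))) = (\<Prod>t\<in>{Suc (k + 1)..Suc (n - 1)}. a t)"
      unfolding prod.shift_bounds_cl_Suc_ivl s a_def ..
    moreover have "Suc (n - 1) = n" using n by simp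
    ultimately show "y r * ((\<Prod>t<k. y (idx n (int (Suc r) + int t))) * (\<Prod>t = k + 1..n - 1. x (idx n (int (Suc r) + int t)))) = T (Suc k)"
      unfolding T_def by simp
  qed
  moreover have "(\<Sum>k<n. T (Suc k)) + T 0 = (\<Sum>k<n. T k) + T n"
    using sum.lessThan_Suc_shift[of T n] sum.lessThan_Suc[of T n] by (simp add: add.commute)
  moreover have "T n = (\<Prod>j\<in>{1..n}. y j)"
    using prod_idx[OF n, of y p] by (simp add: T_def b_def p)
  moreover have "T 0 = (\<Prod>j\<in>{1..n}. x j)"
  proof -
    have "a (Suc t) = x (idx n (int (Suc r) + int t))" for t
      by (simp add: a_def algebra_simps)
    then show ?thesis
      using prod_idx[OF n, of x r] by (simp add: T_def prod.atLeast1_atMost_eq)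
  qed
  ultimately show ?thesis by simp
qed

text \<open>Downward induction on r: with y_n = 0, \<open>kappa_relation\<close> becomes a recursion
  that determines kappa_r after division by x_r.\<close>

lemma kappa_eq_rho:
  assumes y: "X (Suc i, n) = 0" and x: "\<And>s. s \<in> {1..n} \<Longrightarrow> X (i, s) \<noteq> 0"
    and r: "1 \<le> r" "r \<le> n"
  shows "kappa n (row X i) (row X (Suc i)) r = (\<Prod>s\<in>{1..<r}. X (i, s)) * rho i n X r"
  using r(2,1)
proof (induction r rule: inc_induct)
  case base
  have "{1..n} = insert n {1..<n}" using base by auto
  then have "(\<Prod>j = 1..n. X (i, j)) = X (i, n) * (\<Prod>s\<in>{1..<n}. X (i, s))" by simp
  moreover have "(\<Prod>j = 1..n. X (Suc i, j)) = 0"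
    using y base by (intro prod_zero bexI[of _ n]) auto
  ultimately show ?case
    using kappa_relation[of n n "row X (Suc i)" "row X i"] base y x[of n]
    by (simp add: row_def rho_end del: prod_zero_iff)
next
  case (step r)
  then have r: "1 \<le> r" "r < n" by auto
  have y0: "(\<Prod>j = 1..n. X (Suc i, j)) = 0"
    using y r by (intro prod_zero bexI[of _ n]) auto
  have e: "{1..n} = {1..<r} \<union> (insert r {r<..n})" using r by auto
  have "(\<Prod>j = 1..n. X (i, j)) = (\<Prod>s\<in>{1..<r}. X (i, s)) * (X (i, r) * (\<Prod>s\<in>{r<..n}. X (i, s)))"
    unfolding e by (subst prod.union_disjoint) auto
  moreover have "(\<Prod>s\<in>{1..<Suc r}. X (i, s)) = (\<Prod>s\<in>{1..<r}. X (i, s)) * X (i, r)"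
    using r by simp
  ultimately have "X (i, r) * kappa n (row X i) (row X (Suc i)) r
      = X (i, r) * ((\<Prod>s\<in>{1..<r}. X (i, s)) * rho i n X r)"
    using kappa_relation[of r n "row X (Suc i)" "row X i"] step.IH r y0
    by (simp add: row_def rho_step algebra_simps del: prod_zero_iff)
  then show ?case using x[of r] r by simp
qed

text \<open>Upward induction with divisions by entries of the y-row. It starts from kappa_1, which
  is kappa_(n+1) by periodicity and hence determined by \<open>kappa_relation\<close> at column
  n.\<close>

lemma kappa_eq_sig:
  assumes x: "X (i, n) = 0" and y: "\<And>s. s \<in> {1..n} \<Longrightarrow> X (Suc i, s) \<noteq> 0"
    and r: "r < n"
  shows "kappa n (row X i) (row X (Suc i)) (Suc r) = sig n i X r * (\<Prod>s\<in>{r<..<n}. X (Suc i, s))"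
  using r
proof (induction r)
  case 0
  have "{1..n} = insert n {0<..<n}" using 0 by auto
  then have "(\<Prod>j = 1..n. X (Suc i, j)) = X (Suc i, n) * (\<Prod>s\<in>{0<..<n}. X (Suc i, s))" by simp
  moreover have "(\<Prod>j = 1..n. X (i, j)) = 0"
    using x 0 by (intro prod_zero bexI[of _ n]) auto
  ultimately show ?case
    using kappa_relation[of n n "row X (Suc i)" "row X i"] 0 x y[of n]
    by (simp add: row_def kappa_Suc_n del: prod_zero_iff)
next
  case (Suc r)
  have x0: "(\<Prod>j = 1..n. X (i, j)) = 0"
    using x Suc by (intro prod_zero bexI[of _ n]) auto
  have e: "{1..n} = {1..r} \<union> (insert (Suc r) (insert n {Suc r<..<n}))"
    "{r<..<n} = insert (Suc r) {Suc r<..<n}" using Suc by auto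
  have "(\<Prod>j = 1..n. X (Suc i, j))
      = (\<Prod>s\<in>{1..r}. X (Suc i, s)) * (X (Suc i, Suc r) * (X (Suc i, n) * (\<Prod>s\<in>{Suc r<..<n}. X (Suc i, s))))"
    unfolding e using Suc.prems by (subst prod.union_disjoint) auto
  moreover have "(\<Prod>s\<in>{r<..<n}. X (Suc i, s)) = X (Suc i, Suc r) * (\<Prod>s\<in>{Suc r<..<n}. X (Suc i, s))"
    unfolding e by simp
  ultimately have "X (Suc i, Suc r) * kappa n (row X i) (row X (Suc i)) (Suc (Suc r))
      = X (Suc i, Suc r) * (sig n i X (Suc r) * (\<Prod>s\<in>{Suc r<..<n}. X (Suc i, s)))"
    using kappa_relation[of "Suc r" n "row X (Suc i)" "row X i"] Suc x0
    by (simp add: row_def algebra_simps del: prod_zero_iff)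
  then show ?case using y[of "Suc r"] Suc.prems by simp
qed

text \<open>The factors x_1 ... x_(r-1) of kappa_r cancel in the quotients defining R, and those of
  \<open>psi\<close> remain.\<close>

lemma Rop_eq_psi:
  assumes y: "X (Suc i, n) = 0" and x: "\<And>s. s \<in> {1..n} \<Longrightarrow> X (i, s) \<noteq> 0"
    and r: "r \<in> {1..n}"
  shows "Rop n i X (k, r) = psi n i n X (k, r)"
proof -
  note kr = kappa_eq_rho[OF y x, of _]
  have p: "(\<Prod>s\<in>{1..<s}. X (i, s)) \<noteq> 0" if "s \<le> Suc n" for s
    using x that by auto
  show ?thesis
  proof (cases "r < n")
    case True
    then have "(\<Prod>s\<in>{1..<Suc r}. X (i, s)) = (\<Prod>s\<in>{1..<r}. X (i, s)) * X (i, r)"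
      using r by simp
    then show ?thesis
      using True r p[of r] x[of r] kr[of r] kr[of "Suc r"]
      by (auto simp: Rop_def psi_def Rnew_y_def Rnew_x_def row_def)
  next
    case False
    then have rn: "r = n" using r by simp
    have "{1..n} = insert n {1..<n}" using r by auto
    then have "(\<Prod>s\<in>{1..n}. X (i, s)) = X (i, n) * (\<Prod>s\<in>{1..<n}. X (i, s))" by simp
    then show ?thesis
      using rn r y kr[of n] kr[of 1]
      by (auto simp: Rop_def psi_def Rnew_y_def Rnew_x_def row_def kappa_Suc_n rho_end)
  qed
qed

lemma Rop_eq_psi':
  assumes x: "X (i, n) = 0" and y: "\<And>s. s \<in> {1..n} \<Longrightarrow> X (Suc i, s) \<noteq> 0"
    and r: "r \<in> {1..n}"
  shows "Rop n i X (k, r) = psi' n i n X (k, r)"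
proof -
  note ks = kappa_eq_sig[OF x y, of _]
  obtain p where p: "r = Suc p" using r by (cases r) auto
  show ?thesis
  proof (cases "r < n")
    case True
    have "{p<..<n} = insert r {r<..<n}" using True p by auto
    then have "(\<Prod>s\<in>{p<..<n}. X (Suc i, s)) = X (Suc i, r) * (\<Prod>s\<in>{r<..<n}. X (Suc i, s))" by simp
    moreover have "(\<Prod>s\<in>{r<..<n}. X (Suc i, s)) \<noteq> 0" using y r by auto
    ultimately show ?thesis
      using True r p y[of r] ks[of r] ks[of p]
      by (auto simp: Rop_def psi'_def Rnew_y_def Rnew_x_def row_def simp del: sig.simps)
  next
    case False
    then have rn: "r = n" using r by simp
    have "{p<..<n} = {}" "{0<..<n} = {1..n - 1}" using rn p by auto
    then show ?thesis
      using rn r p x ks[of p] ks[of 0]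
      by (auto simp: Rop_def psi'_def Rnew_y_def Rnew_x_def row_def kappa_Suc_n simp del: sig.simps(2))
  qed
qed

text \<open>In the products the \<open>kappa\<close> quotients are inverse to each other. For the
  sums, \<open>kappa_relation\<close> is applied at r and at its cyclic predecessor, and the full
  products of the rows cancel.\<close>

lemma sym2_Rop:
  assumes d: "Rdefined n i X" and r: "r \<in> {1..n}"
  shows "sym2 n i (Rop n i X) (k, r) = sym2 n i X (k, r)"
proof -
  let ?k = "kappa n (row X i) (row X (Suc i))"
  have nz: "?k s \<noteq> 0" if "s \<in> {1..n}" for s
    using d that by (simp add: Rdefined_def)
  define p where "p = prv n r"
  have p: "p \<in> {1..n}" "?k (Suc p) = ?k r"
    using r by (auto simp: p_def prv_def kappa_Suc_n)
  have nzs: "?k (Suc r) \<noteq> 0"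
    using nz[of "Suc r"] nz[of 1] r by (cases "r = n") (auto simp: kappa_Suc_n)
  let ?A = "\<Prod>j = 1..n. X (i, j)" and ?B = "\<Prod>j = 1..n. X (Suc i, j)"
  have "X (Suc i, r) * ?k (Suc r) + X (i, p) * ?k p
      = (X (Suc i, r) * ?k (Suc r) + ?A) + (X (i, p) * ?k p + ?B) - ?A - ?B"
    by simp
  also have "X (Suc i, r) * ?k (Suc r) + ?A = X (i, r) * ?k r + ?B"
    using kappa_relation[of r n "row X (Suc i)" "row X i"] r by (simp add: row_def)
  also have "X (i, p) * ?k p + ?B = X (Suc i, p) * ?k r + ?A"
    using kappa_relation[of p n "row X (Suc i)" "row X i"] p by (simp add: row_def)
  finally have "X (Suc i, r) * ?k (Suc r) + X (i, p) * ?k p = (X (i, r) + X (Suc i, p)) * ?k r"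
    by (simp add: algebra_simps)
  then have "X (Suc i, r) * ?k (Suc r) / ?k r + X (i, p) * ?k p / ?k r = X (i, r) + X (Suc i, p)"
    using nz[OF r] by (simp add: field_simps flip: add_divide_distrib)
  then show ?thesis using nz[OF r] nzs
    by (auto simp: sym2_def Rop_def Rnew_y_def Rnew_x_def p_def[symmetric] p(2)[unfolded row_def] row_def)
qed

lemma kappa_pfun:
  "(\<lambda>X. kappa n (row X i) (row X (Suc i)) r) \<in> pfun UNIV"
  unfolding kappa_def row_def by (auto intro!: pfun_intros)

section \<open>Polynomial invariants of a single R-matrix\<close>

context
  fixes n i :: nat and M :: "nat set" and V
  assumes iM: "i \<in> M" "Suc i \<in> M" and n1: "1 \<le> n"
  defines "V \<equiv> M \<times> {1..n}"
begin

lemma comp_Rop_rfun: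
  assumes f: "f \<in> pfun V"
  shows "rfun (\<lambda>X. \<Prod>r\<in>{1..<Suc n}. kappa n (row X i) (row X (Suc i)) r) (\<lambda>X. f (Rop n i X))"
proof (rule rfun_comp[OF f])
  let ?q = "\<lambda>X. \<Prod>r\<in>{1..<Suc n}. kappa n (row X i) (row X (Suc i)) r"
  show "?q \<in> pfun UNIV" by (intro pfun_prod kappa_pfun)
  fix v assume "v \<in> V"
  then obtain k r where v: "v = (k, r)" "k \<in> M" "r \<in> {1..n}" unfolding V_def by blast
  have dv: "rfun ?q (\<lambda>X. p X / kappa n (row X i) (row X (Suc i)) s)"
    if "p \<in> pfun UNIV" "s \<in> {1..n}" for p s
    by (rule rfun_divide_factor[OF that(1) kappa_pfun]) (use that in auto)
  \<comment> \<open>The denominator at column n + 1 is by periodicity the one at column 1, hence a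
    factor of \<open>?q\<close> as well.\<close>
  have k: "\<exists>s\<in>{1..n}. \<forall>X. kappa n (row X i) (row X (Suc i)) (Suc r) = kappa n (row X i) (row X (Suc i)) s"
    using v(3) n1 by (cases "r = n") (auto simp: kappa_Suc_n)
  then obtain s where s: "s \<in> {1..n}"
    "\<And>X. kappa n (row X i) (row X (Suc i)) (Suc r) = kappa n (row X i) (row X (Suc i)) s" by blast
  consider "k = i" | "k = Suc i" | "k \<noteq> i" "k \<noteq> Suc i" by blast
  then show "rfun ?q (\<lambda>X. Rop n i X v)"
  proof cases
    case 1
    have "rfun ?q (\<lambda>X. X (Suc i, r) * kappa n (row X i) (row X (Suc i)) s / kappa n (row X i) (row X (Suc i)) r)"
      by (rule dv[OF _ v(3)]) (intro pmult kappa_pfun pvar UNIV_I)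
    then show ?thesis using 1 v s by (simp add: Rop_def Rnew_y_def row_def)
  next
    case 2
    have "rfun ?q (\<lambda>X. X (i, r) * kappa n (row X i) (row X (Suc i)) r / kappa n (row X i) (row X (Suc i)) s)"
      by (rule dv[OF _ s(1)]) (intro pmult kappa_pfun pvar UNIV_I)
    then show ?thesis using 2 v s by (simp add: Rop_def Rnew_x_def row_def)
  next
    case 3
    then show ?thesis using rfun_pfun[OF pvar[of v UNIV]] v by (simp add: Rop_def)
  qed
qed

lemma prod_kappa_nonzero_iff:
  "(\<Prod>r\<in>{1..<Suc n}. kappa n (row X i) (row X (Suc i)) r) \<noteq> 0 \<longleftrightarrow> Rdefined n i X"
  unfolding Rdefined_def atLeastLessThanSuc_atLeastAtMost by simp

text \<open>Allows an invariant factor to be cancelled from an identity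
  \<open>f (Rop n i X) = f X\<close>, even though it may vanish somewhere.\<close>

lemma R_eq_dense:
  assumes f: "f \<in> pfun V" and g: "g \<in> pfun UNIV" "b \<in> zs B" "g b \<noteq> 0"
    and eq: "\<And>X. X \<in> zs B \<Longrightarrow> Rdefined n i X \<Longrightarrow> g X \<noteq> 0 \<Longrightarrow> f (Rop n i X) = f X"
    and X: "X \<in> zs B" "Rdefined n i X"
  shows "f (Rop n i X) = f X"
  by (rule rfun_eq_dense[where q="\<lambda>X. \<Prod>r\<in>{1..<Suc n}. kappa n (row X i) (row X (Suc i)) r"
        and F="\<lambda>X. f (Rop n i X)" and G=f, OF _ comp_Rop_rfun[OF f] rfun_pfun[OF f] g])
    (use assms in \<open>simp_all only: prod_kappa_nonzero_iff pfun_prod kappa_pfun\<close>)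

lemma comp_sym2_Rop:
  assumes "P \<in> pfun V" "Rdefined n i X"
  shows "P (sym2 n i (Rop n i X)) = P (sym2 n i X)"
proof (rule pfun_cong[OF assms(1)])
  fix v assume "v \<in> V"
  then obtain k r where "v = (k, r)" "r \<in> {1..n}" unfolding V_def by blast
  then show "sym2 n i (Rop n i X) v = sym2 n i X v" using sym2_Rop[OF assms(2)] by simp
qed

text \<open>Where the other row has no zero entry and the denominators of \<open>psi\<close> or
  \<open>psi'\<close> are nonzero, all \<open>kappa\<close> are nonzero and R is that map. Density
  removes the condition on the row.\<close>

lemma R_invariant_imp_compat:
  assumes f: "f \<in> pfun V" and inv: "R_invariant n i f"
  shows "compat_pair n i n f f"
  unfolding compat_pair_def
proof (intro conjI ballI impI)
  fix X assume X: "X \<in> zs (tail n (Suc i) n)" and nz: "\<forall>r\<in>{1..<n}. rho i n X r \<noteq> 0"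
  show "f X = f (psi n i n X)"
  proof (rule rfun_eq_dense[where q="\<lambda>X. \<Prod>r\<in>{1..<n}. rho i n X r" and F=f
        and G="\<lambda>X. f (psi n i n X)" and g="\<lambda>X. \<Prod>s\<in>{1..n}. X (i, s)"
        and B="tail n (Suc i) n" and b="off (tail n (Suc i) n)"])
    show "(\<lambda>X. \<Prod>r = 1..<n. rho i n X r) \<in> pfun UNIV" by (intro pfun_prod rho_pfun)
    show "(\<lambda>X. \<Prod>s\<in>{1..n}. X (i, s)) \<in> pfun UNIV" by (intro pfun_prod pvar UNIV_I)
    show "rfun (\<lambda>X. \<Prod>r = 1..<n. rho i n X r) f" by (rule rfun_pfun[OF f])
    show "rfun (\<lambda>X. \<Prod>r = 1..<n. rho i n X r) (\<lambda>X. f (psi n i n X))"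
      using comp_psi_rfun[OF iM n1 f[unfolded V_def] n1] by simp
    fix X assume X: "X \<in> zs (tail n (Suc i) n)"
      and q: "(\<Prod>r = 1..<n. rho i n X r) \<noteq> 0" and g: "(\<Prod>s\<in>{1..n}. X (i, s)) \<noteq> 0"
    have y: "X (Suc i, n) = 0" using X by (simp add: zs_def)
    have x: "X (i, s) \<noteq> 0" if "s \<in> {1..n}" for s using g that by auto
    have r: "rho i n X r \<noteq> 0" if "r \<in> {1..n}" for r
      using q that by (cases "r = n") (auto simp: rho_end)
    have "kappa n (row X i) (row X (Suc i)) r \<noteq> 0" if "r \<in> {1..n}" for r
      using kappa_eq_rho[OF y x, of r] r[OF that] x that by auto
    then have "Rdefined n i X" by (simp add: Rdefined_def)
    then have "f X = f (Rop n i X)" using inv by (simp add: R_invariant_def)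
    also have "\<dots> = f (psi n i n X)"
    proof (rule pfun_cong[OF f])
      fix v assume "v \<in> V"
      then obtain k r where "v = (k, r)" "r \<in> {1..n}" unfolding V_def by blast
      then show "Rop n i X v = psi n i n X v" using Rop_eq_psi[OF y x] by simp
    qed
    finally show "f X = f (psi n i n X)" .
  qed (use X nz in \<open>auto simp: off_in_zs off_def\<close>)
next
  fix X assume X: "X \<in> zs (tail n i n)" and nz: "\<forall>r\<in>{1..<n}. sig n i X r \<noteq> 0"
  show "f X = f (psi' n i n X)"
  proof (rule rfun_eq_dense[where q="\<lambda>X. \<Prod>r\<in>{1..<n}. sig n i X r" and F=f
        and G="\<lambda>X. f (psi' n i n X)" and g="\<lambda>X. \<Prod>s\<in>{1..n}. X (Suc i, s)"
        and B="tail n i n" and b="off (tail n i n)"])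
    show "(\<lambda>X. \<Prod>r = 1..<n. sig n i X r) \<in> pfun UNIV" by (intro pfun_prod sig_pfun)
    show "(\<lambda>X. \<Prod>s\<in>{1..n}. X (Suc i, s)) \<in> pfun UNIV" by (intro pfun_prod pvar UNIV_I)
    show "rfun (\<lambda>X. \<Prod>r = 1..<n. sig n i X r) f" by (rule rfun_pfun[OF f])
    show "rfun (\<lambda>X. \<Prod>r = 1..<n. sig n i X r) (\<lambda>X. f (psi' n i n X))"
      using comp_psi'_rfun[OF iM n1 f[unfolded V_def] n1] by simp
    fix X assume X: "X \<in> zs (tail n i n)"
      and q: "(\<Prod>r = 1..<n. sig n i X r) \<noteq> 0" and g: "(\<Prod>s\<in>{1..n}. X (Suc i, s)) \<noteq> 0"
    have x: "X (i, n) = 0" using X by (simp add: zs_def)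
    have y: "X (Suc i, s) \<noteq> 0" if "s \<in> {1..n}" for s using g that by auto
    have s: "sig n i X r \<noteq> 0" if "r < n" for r
      using q that by (cases "r = 0") auto
    have "kappa n (row X i) (row X (Suc i)) (Suc r) \<noteq> 0" if "r < n" for r
      using kappa_eq_sig[OF x y that] s[OF that] y by auto
    then have "kappa n (row X i) (row X (Suc i)) r \<noteq> 0" if "r \<in> {1..n}" for r
      using that by (cases r) auto
    then have "Rdefined n i X" by (simp add: Rdefined_def)
    then have "f X = f (Rop n i X)" using inv by (simp add: R_invariant_def)
    also have "\<dots> = f (psi' n i n X)"
    proof (rule pfun_cong[OF f])
      fix v assume "v \<in> V"
      then obtain k r where "v = (k, r)" "r \<in> {1..n}" unfolding V_def by blast
      then show "Rop n i X v = psi' n i n X v" using Rop_eq_psi'[OF x y] by simp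
    qed
    finally show "f X = f (psi' n i n X)" .
  qed (use X nz in \<open>auto simp: off_in_zs off_def\<close>)
qed

text \<open>The two-row result with all other rows as parameters. \<open>compat_imp_sym2\<close> at
  N = n provides a polynomial to subtract; the difference is x_n y_n times an invariant of smaller
  degree.\<close>

lemma R_invariant_imp_sym2:
  assumes "f \<in> pdeg V (\<lambda>_. 1) d" "R_invariant n i f"
  shows "\<exists>P\<in>pdeg V (w2 i) d. \<forall>X. f X = P (sym2 n i X)"
  using assms
proof (induction "nat (d + 1)" arbitrary: d f rule: less_induct)
  case less
  show ?case
  proof (cases "d < 0")
    case True
    then have "f X = 0" for X using pdeg_neg[OF less.prems(1)] by auto
    then show ?thesis by (intro bexI[of _ "\<lambda>_. 0"]) (auto intro: pdeg_zero)
  next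
    case False
    have pf: "f \<in> pfun V" by (rule pdeg_imp_pfun[OF less.prems(1)])
    have tl: "tail n k n = {(k, n)}" for k :: nat by auto
    obtain P0 where P0: "P0 \<in> pdeg V (w2 i) d"
      and P0f: "\<And>X. X \<in> zs {(Suc i, n)} \<Longrightarrow> f X = P0 (sym2 n i X)"
      "\<And>X. X \<in> zs {(i, n)} \<Longrightarrow> f X = P0 (sym2 n i X)"
      using compat_imp_sym2[OF iM n1 n1 order_refl, of f d f]
        R_invariant_imp_compat[OF pf less.prems(2)] less.prems(1) unfolding tl V_def by auto
    have P0S: "(\<lambda>X. P0 (sym2 n i X)) \<in> pdeg V (\<lambda>_. 1) d"
      using comp_sym2_pdeg[OF iM n1] P0 unfolding V_def by blast
    define g where "g = (\<lambda>X. f X - P0 (sym2 n i X))"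
    have g: "g \<in> pdeg V (\<lambda>_. 1) d" unfolding g_def by (intro pdeg_diff less.prems P0S)
    have ginv: "R_invariant n i g"
      using less.prems(2) comp_sym2_Rop[OF pdeg_imp_pfun[OF P0]] by (simp add: R_invariant_def g_def)
    have nn: "n \<in> {1..n}" using n1 by simp
    obtain h where h: "h \<in> pdeg V (\<lambda>_. 1) (d - 2)"
      and gh: "\<And>X. X \<in> zs {} \<Longrightarrow> g X = X (i, n) * X (Suc i, n) * h X"
      by (rule pdeg_divide_pair[OF iM n1 g[unfolded V_def] nn, of "{}"])
        (use P0f in \<open>auto simp: g_def V_def\<close>)
    have gh: "g X = X (i, n) * X (Suc i, n) * h X" for X using gh by (simp add: zs_def)
    have "h (Rop n i X) = h X" if X: "Rdefined n i X" for X
    proof (rule R_eq_dense[OF pdeg_imp_pfun[OF h], where g="\<lambda>X. X (i, n) * X (Suc i, n)" and b="\<lambda>_. 1" and B="{}"])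
      fix X assume d: "Rdefined n i X" and nz: "X (i, n) * X (Suc i, n) \<noteq> 0"
      have "sym2 n i (Rop n i X) (Suc i, n) = sym2 n i X (Suc i, n)"
        by (rule sym2_Rop[OF d nn])
      then have "Rop n i X (i, n) * Rop n i X (Suc i, n) = X (i, n) * X (Suc i, n)"
        by (simp add: sym2_def)
      moreover have "g (Rop n i X) = g X" using ginv d by (simp add: R_invariant_def)
      ultimately show "h (Rop n i X) = h X" using nz unfolding gh by simp
    qed (use X in \<open>auto simp: zs_def intro!: pfun_intros\<close>)
    then have "R_invariant n i h" by (simp add: R_invariant_def)
    then obtain P1 where P1: "P1 \<in> pdeg V (w2 i) (d - 2)" and hP1: "\<And>X. h X = P1 (sym2 n i X)"
      using less.hyps[of "d - 2" h] h False by auto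
    define P where "P = (\<lambda>Y. P0 Y + Y (Suc i, n) * P1 Y)"
    have "(\<lambda>Y::mat. Y (Suc i, n)) \<in> pdeg V (w2 i) 2"
      using iM nn by (intro pdeg_var) (auto simp: V_def w2_def)
    then have "P \<in> pdeg V (w2 i) d"
      unfolding P_def by (intro pdeg_add[OF P0] pdeg_mult[OF _ P1]) auto
    moreover have "f X = P (sym2 n i X)" for X
      using gh[of X] hP1[of X] by (simp add: g_def P_def sym2_def algebra_simps)
    ultimately show ?thesis by blast
  qed
qed

end

section \<open>Loop elementary symmetric functions\<close>

lemma sym2_in_zs:
  assumes "X \<in> zs ({Suc i} \<times> J \<union> B)" "\<And>k r. (k, r) \<in> B \<Longrightarrow> k \<noteq> i \<and> k \<noteq> Suc i"
  shows "sym2 n i X \<in> zs ({Suc i} \<times> J \<union> B)"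
  unfolding zs_def
proof (intro CollectI ballI)
  fix v assume v: "v \<in> {Suc i} \<times> J \<union> B"
  obtain k r where kr: "v = (k, r)" by (cases v)
  have "X v = 0" using assms(1) v by (simp add: zs_def)
  then show "sym2 n i X v = 0" using v assms(2)[of k r] kr by (auto simp: sym2_def)
qed

text \<open>\<open>sym2\<close> maps the subspace to a dense part of itself. If row
  \<open>Suc i\<close> is zero, it is the identity. Otherwise, for a column j outside
  \<open>J\<close>, the case of \<open>insert j J\<close> makes \<open>Q\<close> divisible by its
  entry at \<open>(Suc i, j)\<close>, and the quotient satisfies the same hypothesis with a smaller
  degree. \<open>B\<close> allows further zeros in other rows.\<close>

lemma sym2_dominant:
  assumes iM: "i \<in> M" "Suc i \<in> M" and n1: "1 \<le> n" and J: "J \<subseteq> {1..n}"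
    and B: "\<And>k r. (k, r) \<in> B \<Longrightarrow> k \<noteq> i \<and> k \<noteq> Suc i"
    and Q: "Q \<in> pfun (M \<times> {1..n})"
    and v: "\<And>X. X \<in> zs ({Suc i} \<times> J \<union> B) \<Longrightarrow> Q (sym2 n i X) = 0"
    and Y: "Y \<in> zs ({Suc i} \<times> J \<union> B)"
  shows "Q Y = 0"
proof -
  let ?V = "M \<times> {1..n}"
  have "\<forall>Y\<in>zs ({Suc i} \<times> J \<union> B). Q Y = 0"
    if "Q \<in> pdeg ?V (w2 i) d" "J \<subseteq> {1..n}" "\<forall>X\<in>zs ({Suc i} \<times> J \<union> B). Q (sym2 n i X) = 0" for Q d J
    using that
  proof (induction "card ({1..n} - J)" arbitrary: J Q d)
    case 0
    then have J: "J = {1..n}" by auto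
    show ?case
    proof
      fix Y assume Y: "Y \<in> zs ({Suc i} \<times> J \<union> B)"
      have "Q (sym2 n i Y) = Q Y"
      proof (rule pfun_cong[OF pdeg_imp_pfun[OF 0(2)]])
        fix v assume "v \<in> ?V"
        then obtain k r where v: "v = (k, r)" "r \<in> {1..n}" by blast
        then have "prv n r \<in> {1..n}" by (auto simp: prv_def)
        then have "Y (Suc i, prv n r) = 0" "Y (Suc i, r) = 0"
          using Y v unfolding J by (auto simp: zs_def)
        then show "sym2 n i Y v = Y v" using v(1) by (simp add: sym2_def)
      qed
      then show "Q Y = 0" using 0(4) Y by simp
    qed
  next
    case (Suc c)
    then have "{1..n} - J \<noteq> {}" by (metis card.empty nat.distinct(1))
    then obtain j where j: "j \<in> {1..n}" "j \<notin> J" by blast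
    have "{1..n} - J = insert j ({1..n} - insert j J)" using j by auto
    then have c: "c = card ({1..n} - insert j J)"
      using Suc.hyps(2) by (metis (no_types, lifting) DiffE card_insert_disjoint
          finite_Diff finite_atLeastAtMost insertI1 nat.inject)
    let ?C = "{Suc i} \<times> J \<union> B"
    have ins: "insert (Suc i, j) ?C = {Suc i} \<times> insert j J \<union> B" by auto
    show ?case using Suc.prems(1,3)
    proof (induction "nat (d + 1)" arbitrary: d Q rule: less_induct)
      case less
      show ?case
      proof (cases "d < 0")
        case True
        then show ?thesis using pdeg_neg[OF less.prems(1)] by auto
      next
        case False
        have "\<forall>Y\<in>zs ({Suc i} \<times> insert j J \<union> B). Q Y = 0"
          by (rule Suc.hyps(1)[OF c less.prems(1)])
            (use Suc.prems(2) j less.prems(2) in \<open>auto simp: zs_def\<close>)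
        then obtain h where h: "h \<in> pdeg ?V (w2 i) (d - int (w2 i (Suc i, j)))"
          and Qh: "\<And>Y. Y \<in> zs ?C \<Longrightarrow> Q Y = Y (Suc i, j) * h Y"
          using pdeg_divide_var[OF less.prems(1), of "(Suc i, j)" ?C] unfolding ins by blast
        \<comment> \<open>The entry divided out becomes x_j y_j under \<open>sym2\<close>, which is
          not identically zero on the subspace.\<close>
        have "h (sym2 n i X) = 0" if X: "X \<in> zs ?C" for X
        proof (rule pfun_eq_0_dense[where f="\<lambda>X. h (sym2 n i X)" and g="\<lambda>X. X (i, j) * X (Suc i, j)"
              and W=UNIV and B="?C" and b="off ?C", OF pdeg_imp_pfun[OF comp_sym2_pdeg[OF iM n1 h]]])
          show "h (sym2 n i X) * (X (i, j) * X (Suc i, j)) = 0" if X: "X \<in> zs ?C" for X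
            using Qh[OF sym2_in_zs[OF X B]] less.prems(2) X by (auto simp: sym2_def)
          show "off ?C (i, j) * off ?C (Suc i, j) \<noteq> 0"
            using j B by (auto simp: off_def)
        qed (use X in \<open>auto intro!: pfun_intros simp: off_in_zs\<close>)
        then have "\<forall>Y\<in>zs ?C. h Y = 0"
          using less.hyps[OF _ h] False by (auto simp: w2_def)
        then show ?thesis using Qh by auto
      qed
    qed
  qed
  then show ?thesis using pfun_imp_pdeg[OF Q, of "w2 i"] J v Y by blast
qed

section \<open>Recursion and invariance of the loop elementary symmetric functions\<close>

definition inc_maps :: "nat \<Rightarrow> nat \<Rightarrow> (nat \<Rightarrow> nat) set" where
  "inc_maps m k = {s \<in> {1..k} \<rightarrow>\<^sub>E {1..m}. strict_mono_on {1..k} s}"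

lemma finite_inc_maps: "finite (inc_maps m k)"
  unfolding inc_maps_def
  by (rule finite_subset[of _ "{1..k} \<rightarrow>\<^sub>E {1..m}"]) (auto intro: finite_PiE)

lemma inc_maps_Suc:
  "inc_maps (Suc m) (Suc k) = inc_maps m (Suc k) \<union> (\<lambda>s. s(Suc k := Suc m)) ` inc_maps m k"
proof (intro equalityI subsetI)
  fix s assume s: "s \<in> inc_maps (Suc m) (Suc k)"
  then have mono: "\<And>a b. a \<in> {1..Suc k} \<Longrightarrow> b \<in> {1..Suc k} \<Longrightarrow> a < b \<Longrightarrow> s a < s b"
    and ran: "\<And>a. a \<in> {1..Suc k} \<Longrightarrow> s a \<in> {1..Suc m}" and ext: "s \<in> extensional {1..Suc k}"
    by (auto simp: inc_maps_def strict_mono_on_def PiE_def Pi_def)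
  show "s \<in> inc_maps m (Suc k) \<union> (\<lambda>s. s(Suc k := Suc m)) ` inc_maps m k"
  proof (cases "s (Suc k) = Suc m")
    case True
    \<comment> \<open>The value is reset to \<open>undefined\<close> because the shortened map must
      be extensional on \<open>{1..k}\<close>.\<close>
    let ?t = "s(Suc k := undefined)"
    have "?t a \<in> {1..m}" if "a \<in> {1..k}" for a
      using ran[of a] mono[of a "Suc k"] that True by auto
    then have "?t \<in> inc_maps m k"
      using mono ext by (auto simp: inc_maps_def strict_mono_on_def PiE_def Pi_def extensional_def)
    moreover have "s = ?t(Suc k := Suc m)" using True by auto
    ultimately show ?thesis by blast
  next
    case False
    have "s a \<in> {1..m}" if a: "a \<in> {1..Suc k}" for a
      using ran[OF a] ran[of "Suc k"] mono[of a "Suc k"] False a by (cases "a = Suc k") auto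
    then have "s \<in> inc_maps m (Suc k)"
      using mono ext by (auto simp: inc_maps_def strict_mono_on_def PiE_def Pi_def)
    then show ?thesis by blast
  qed
next
  fix s assume "s \<in> inc_maps m (Suc k) \<union> (\<lambda>s. s(Suc k := Suc m)) ` inc_maps m k"
  then show "s \<in> inc_maps (Suc m) (Suc k)"
    by (fastforce simp: inc_maps_def strict_mono_on_def PiE_def Pi_def extensional_def)
qed

lemma loop_e_inc_maps:
  "loop_e m n k r X = (\<Sum>s\<in>inc_maps m k. \<Prod>t\<in>{1..k}. xr n X (s t) (r + t - 1))"
  by (simp add: loop_e_def inc_maps_def)

lemma loop_e_0: "loop_e m n 0 r X = 1"
proof -
  have "inc_maps m 0 = {\<lambda>_. undefined}"
    by (auto simp: inc_maps_def strict_mono_on_def)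
  then show ?thesis by (simp add: loop_e_inc_maps)
qed

lemma loop_e_rows_0: "loop_e 0 n (Suc k) r X = 0"
proof -
  have "inc_maps 0 (Suc k) = {}"
    by (auto simp: inc_maps_def PiE_def Pi_def)
  then show ?thesis by (simp add: loop_e_inc_maps)
qed

text \<open>If row \<open>Suc m\<close> is chosen it comes last, so its factor carries the
  superscript r + k.\<close>

lemma loop_e_Suc:
  "loop_e (Suc m) n (Suc k) r X = loop_e m n (Suc k) r X + loop_e m n k r X * xr n X (Suc m) (r + k)"
proof -
  let ?u = "\<lambda>s::nat \<Rightarrow> nat. s(Suc k := Suc m)"
  let ?p = "\<lambda>k s. \<Prod>t\<in>{1..k}. xr n X (s t) (r + t - 1)"
  have ext: "s (Suc k) = undefined" if "s \<in> inc_maps m k" for s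
    using that by (auto simp: inc_maps_def PiE_def extensional_def)
  have inj: "inj_on ?u (inc_maps m k)"
  proof (rule inj_onI)
    fix s t assume "s \<in> inc_maps m k" "t \<in> inc_maps m k" "?u s = ?u t"
    then show "s = t" using ext by (metis fun_upd_triv fun_upd_upd)
  qed
  have disj: "inc_maps m (Suc k) \<inter> ?u ` inc_maps m k = {}"
    by (fastforce simp: inc_maps_def PiE_def Pi_def)
  have "loop_e (Suc m) n (Suc k) r X = (\<Sum>s\<in>inc_maps m (Suc k). ?p (Suc k) s) + (\<Sum>s\<in>?u ` inc_maps m k. ?p (Suc k) s)"
    unfolding loop_e_inc_maps inc_maps_Suc
    by (rule sum.union_disjoint) (use disj finite_inc_maps in auto)
  also have "(\<Sum>s\<in>?u ` inc_maps m k. ?p (Suc k) s) = (\<Sum>s\<in>inc_maps m k. ?p k s * xr n X (Suc m) (r + k))"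
  proof (subst sum.reindex[OF inj], rule sum.cong[OF refl])
    fix s assume "s \<in> inc_maps m k"
    have "(\<Prod>t\<in>{1..k}. xr n X (?u s t) (r + t - 1)) = ?p k s"
      by (rule prod.cong) auto
    then show "(?p (Suc k) \<circ> ?u) s = ?p k s * xr n X (Suc m) (r + k)"
      by simp
  qed
  finally show ?thesis by (simp add: loop_e_inc_maps sum_distrib_right)
qed

lemma loop_e_above: "m < k \<Longrightarrow> loop_e m n k r X = 0"
proof (induction m arbitrary: k)
  case 0
  then show ?case by (cases k) (auto simp: loop_e_rows_0)
next
  case (Suc m)
  then obtain l where "k = Suc l" "m < l" by (cases k) auto
  then show ?case using Suc.IH by (simp add: loop_e_Suc)
qed

lemma loop_e_cong:
  assumes "\<And>a j. a \<le> m \<Longrightarrow> X (a, j) = Y (a, j)"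
  shows "loop_e m n k r X = loop_e m n k r Y"
  unfolding loop_e_inc_maps
proof (intro sum.cong prod.cong refl)
  fix s t assume "s \<in> inc_maps m k" "t \<in> {1..k}"
  then have "s t \<le> m" by (auto simp: inc_maps_def PiE_def Pi_def)
  then show "xr n X (s t) (r + t - 1) = xr n Y (s t) (r + t - 1)"
    unfolding xr_def by (rule assms)
qed

text \<open>All rows are chosen, and the growing superscript is undone by the row shift in
  \<open>xr\<close>, so the factors form one column.\<close>

lemma loop_e_top:
  assumes "r \<in> {1..n}"
  shows "loop_e m n m r X = (\<Prod>k\<in>{1..m}. X (k, r))"
proof (induction m)
  case 0
  show ?case by (simp add: loop_e_0)
next
  case (Suc m)
  have "xr n X (Suc m) (r + m) = X (Suc m, r)"
    using idx_of_nat[of r n] assms by (simp add: xr_def)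
  then show ?case using Suc by (simp add: loop_e_Suc loop_e_above)
qed

lemma loop_e_zero_row:
  assumes "1 \<le> n" "\<And>j. j \<in> {1..n} \<Longrightarrow> X (Suc m, j) = 0"
  shows "loop_e (Suc m) n k r X = loop_e m n k r X"
proof (cases k)
  case 0
  then show ?thesis by (simp add: loop_e_0)
next
  case (Suc l)
  have "xr n X (Suc m) (r + l) = 0"
    unfolding xr_def using assms idx_in by blast
  then show ?thesis using Suc by (simp add: loop_e_Suc)
qed

lemma loop_e_pdeg:
  assumes "1 \<le> n"
  shows "loop_e m n k r \<in> pdeg ({1..m} \<times> {1..n}) (\<lambda>_. 1) (int k)"
proof -
  have "(\<lambda>X. \<Sum>s\<in>inc_maps m k. \<Prod>t\<in>{1..k}. xr n X (s t) (r + t - 1)) \<in> pdeg ({1..m} \<times> {1..n}) (\<lambda>_. 1) (int k)"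
  proof (rule pdeg_sum)
    fix s assume s: "s \<in> inc_maps m k"
    have "(\<lambda>X. \<Prod>t\<in>{1..k}. xr n X (s t) (r + t - 1)) \<in> pdeg ({1..m} \<times> {1..n}) (\<lambda>_. 1) (int (\<Sum>t\<in>{1..k}. 1))"
    proof (rule pdeg_prod)
      fix t assume "t \<in> {1..k}"
      then have "s t \<in> {1..m}" using s by (auto simp: inc_maps_def PiE_def Pi_def)
      then show "(\<lambda>X. xr n X (s t) (r + t - 1)) \<in> pdeg ({1..m} \<times> {1..n}) (\<lambda>_. 1) (int 1)"
        unfolding xr_def using idx_in[OF assms] by (intro pdeg_var) auto
    qed
    then show "(\<lambda>X. \<Prod>t\<in>{1..k}. xr n X (s t) (r + t - 1)) \<in> pdeg ({1..m} \<times> {1..n}) (\<lambda>_. 1) (int k)"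
      by simp
  qed
  then show ?thesis by (simp add: loop_e_inc_maps[abs_def])
qed

lemma prv_idx:
  assumes "1 \<le> n"
  shows "prv n (idx n (j + 1)) = idx n j"
proof -
  have n: "int n > 0" using assms by simp
  have b: "0 \<le> j mod int n" "j mod int n < int n" using n by auto
  have "(j - 1) mod int n = (if j mod int n = 0 then int n - 1 else j mod int n - 1)"
  proof (cases "j mod int n = 0")
    case True
    have "(j - 1) mod int n = (j mod int n - 1) mod int n" by (simp add: mod_diff_left_eq)
    also have "\<dots> = (- 1) mod int n" using True by simp
    also have "\<dots> = int n - 1" using n by (simp add: zmod_minus1)
    finally show ?thesis using True by simp
  next
    case False
    have "(j - 1) mod int n = (j mod int n - 1) mod int n" by (simp add: mod_diff_left_eq)
    also have "\<dots> = j mod int n - 1" using False b by (intro mod_pos_pos_trivial) auto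
    finally show ?thesis using False by simp
  qed
  then have i1: "idx n j = nat (if j mod int n = 0 then int n - 1 else j mod int n - 1) + 1"
    by (simp add: idx_def)
  have i2: "idx n (j + 1) = nat (j mod int n) + 1" by (simp add: idx_def)
  show ?thesis
  proof (cases "j mod int n = 0")
    case True
    then show ?thesis unfolding i1 i2 using n by (simp add: prv_def nat_diff_distrib)
  next
    case False
    then have "nat (j mod int n) > 0" using b by simp
    then show ?thesis unfolding i1 i2 using False by (simp add: prv_def nat_diff_distrib)
  qed
qed

text \<open>Expanding twice by \<open>loop_e_Suc\<close>, the last two rows enter only through their
  two-row sums and products.\<close>

lemma loop_e_sym2:
  assumes n: "1 \<le> n" and eq: "\<And>k r. r \<in> {1..n} \<Longrightarrow> sym2 n (Suc p) X (k, r) = sym2 n (Suc p) Y (k, r)"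
    and rows: "\<And>a j. a \<le> p \<Longrightarrow> X (a, j) = Y (a, j)"
  shows "loop_e (Suc (Suc p)) n k r X = loop_e (Suc (Suc p)) n k r Y"
proof -
  have add: "xr n X (Suc p) s + xr n X (Suc (Suc p)) s = xr n Y (Suc p) s + xr n Y (Suc (Suc p)) s" for s
  proof -
    have "int s - int (Suc p) = int s - int (Suc (Suc p)) + 1" by simp
    then have "prv n (idx n (int s - int (Suc p) + 1)) = idx n (int s - int (Suc (Suc p)) + 1)"
      using prv_idx[OF n, of "int s - int (Suc (Suc p)) + 1"] by (simp only:)
    then show ?thesis
      using eq[OF idx_in[OF n], of "Suc p" "int s - int (Suc p) + 1"]
      by (simp add: sym2_def xr_def)
  qed
  have mul: "xr n X (Suc p) s * xr n X (Suc (Suc p)) (Suc s) = xr n Y (Suc p) s * xr n Y (Suc (Suc p)) (Suc s)" for s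
    using eq[OF idx_in[OF n], of "Suc (Suc p)" "int s - int (Suc p) + 1"]
    by (simp add: sym2_def xr_def)
  have e: "loop_e p n k r X = loop_e p n k r Y" for k
    by (rule loop_e_cong) (rule rows)
  consider "k = 0" | "k = Suc 0" | l where "k = Suc (Suc l)"
    by (metis not0_implies_Suc)
  then show ?thesis
  proof cases
    case 1
    then show ?thesis by (simp add: loop_e_0)
  next
    case 2
    then show ?thesis using add[of r] e[of "Suc 0"]
      by (simp add: loop_e_Suc loop_e_0 add.assoc)
  next
    case 3
    have "loop_e (Suc (Suc p)) n k r Z = loop_e p n (Suc (Suc l)) r Z
        + loop_e p n (Suc l) r Z * (xr n Z (Suc p) (Suc (r + l)) + xr n Z (Suc (Suc p)) (Suc (r + l)))
        + loop_e p n l r Z * (xr n Z (Suc p) (r + l) * xr n Z (Suc (Suc p)) (Suc (r + l)))" for Z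
      unfolding 3 by (simp add: loop_e_Suc algebra_simps)
    then show ?thesis by (simp add: e add mul)
  qed
qed

text \<open>If the two affected rows are the last ones, this is \<open>sym2_Rop\<close>. Later rows
  are untouched and are added by the recursion.\<close>

lemma loop_e_Rop:
  assumes n: "1 \<le> n" and i: "1 \<le> i" "Suc i \<le> m" and d: "Rdefined n i X"
  shows "loop_e m n k r (Rop n i X) = loop_e m n k r X"
  using i(2)
proof (induction m arbitrary: k rule: dec_induct)
  case base
  obtain p where p: "i = Suc p" using i by (cases i) auto
  show ?case unfolding p
    by (rule loop_e_sym2[OF n]) (use sym2_Rop[OF d] in \<open>auto simp: p Rop_def\<close>)
next
  case (step m)
  have "xr n (Rop n i X) (Suc m) s = xr n X (Suc m) s" for s
    using step by (auto simp: xr_def Rop_def)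
  then show ?case using step by (cases k) (auto simp: loop_e_0 loop_e_Suc)
qed

text \<open>The invariants arranged as a matrix, so that polynomials in them use the same variables;
  \<open>fst\<close> as weight records the degree k of e_k.\<close>

definition emap :: "nat \<Rightarrow> nat \<Rightarrow> mat \<Rightarrow> mat" where
  "emap m n X = (\<lambda>(k, r). loop_e m n k r X)"

lemma emap_pdeg:
  assumes "1 \<le> n" "P \<in> pdeg ({1..m} \<times> {1..n}) fst d"
  shows "(\<lambda>X. P (emap m n X)) \<in> pdeg ({1..m} \<times> {1..n}) (\<lambda>_. 1) d"
proof (rule pdeg_comp[OF assms(2)])
  fix v assume "v \<in> {1..m} \<times> {1..n}"
  obtain k r where v: "v = (k, r)" by (cases v)
  then show "(\<lambda>X. emap m n X v) \<in> pdeg ({1..m} \<times> {1..n}) (\<lambda>_. 1) (int (fst v))"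
    using loop_e_pdeg[OF assms(1), of m k r] by (simp add: emap_def)
qed

lemma emap_Rop:
  assumes "1 \<le> n" "1 \<le> i" "Suc i \<le> m" "Rdefined n i X"
  shows "emap m n (Rop n i X) = emap m n X"
  by (auto simp: emap_def loop_e_Rop[OF assms])

lemma emap_zero_row:
  assumes "1 \<le> n" "\<And>j. j \<in> {1..n} \<Longrightarrow> X (Suc m, j) = 0"
  shows "emap (Suc m) n X = emap m n X"
  using loop_e_zero_row[of n X m] assms by (auto simp: emap_def)

section \<open>Induction on the number of rows\<close>

text \<open>Shows that R is still generically defined where an entry of its first row is
  zero.\<close>

lemma kappa_const_0_1: "1 \<le> n \<Longrightarrow> kappa n (\<lambda>_. 0) (\<lambda>_. 1) r = 1"
proof -
  assume n: "1 \<le> n"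
  then obtain p where p: "n = Suc p" by (cases n) auto
  have "kappa n (\<lambda>_. 0) (\<lambda>_. 1) r = (\<Sum>k<n. if k = p then 1 else 0)"
    unfolding kappa_def by (rule sum.cong) (auto simp: p)
  then show ?thesis by (simp add: p)
qed

text \<open>R_m in general destroys the zeros in row \<open>Suc m\<close>, so invariance under it is
  replaced by the existence of \<open>Q\<close>. The earlier R_i do not touch that row, and their
  invariance can be stated on the subspace.\<close>

lemma R_invariant_imp_emap_step:
  assumes n1: "1 \<le> n" and m1: "1 \<le> m"
    and IH: "\<And>d f. f \<in> pdeg ({1..m} \<times> {1..n}) (\<lambda>_. 1) d \<Longrightarrow> (\<And>i. i \<in> {1..<m} \<Longrightarrow> R_invariant n i f) \<Longrightarrow>
      \<exists>P\<in>pdeg ({1..m} \<times> {1..n}) fst d. \<forall>X. f X = P (emap m n X)"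
    and J: "J \<subseteq> {1..n}" and f: "f \<in> pdeg ({1..Suc m} \<times> {1..n}) (\<lambda>_. 1) d"
    and inv: "\<forall>i\<in>{1..<m}. \<forall>X\<in>zs ({Suc m} \<times> J). Rdefined n i X \<longrightarrow> f (Rop n i X) = f X"
    and Q: "\<exists>Q\<in>pfun ({1..Suc m} \<times> {1..n}). \<forall>X\<in>zs ({Suc m} \<times> J). f X = Q (sym2 n m X)"
  shows "\<exists>P\<in>pdeg ({1..Suc m} \<times> {1..n}) fst d. \<forall>X\<in>zs ({Suc m} \<times> J). f X = P (emap (Suc m) n X)"
  using J f inv Q
proof (induction "card ({1..n} - J)" arbitrary: J f d)
  case 0
  then have J: "J = {1..n}" by auto
  \<comment> \<open>\<open>J\<close> is now all columns, so erasing the last row does not change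
    \<open>f\<close> on the subspace and leaves an invariant of m rows.\<close>
  define Z :: "mat \<Rightarrow> mat" where "Z X = (\<lambda>(k, r). if k = Suc m then 0 else X (k, r))" for X
  have ZJ: "Z X \<in> zs ({Suc m} \<times> J)" for X by (auto simp: zs_def Z_def)
  have "(\<lambda>X. f (Z X)) \<in> pdeg ({1..m} \<times> {1..n}) (\<lambda>_. 1) d"
  proof (rule pdeg_comp[OF 0(3)])
    fix v assume v: "v \<in> {1..Suc m} \<times> {1..n}"
    obtain k r where kr: "v = (k, r)" by (cases v)
    show "(\<lambda>X. Z X v) \<in> pdeg ({1..m} \<times> {1..n}) (\<lambda>_. 1) (int 1)"
      using v unfolding kr Z_def
      by (cases "k = Suc m") (simp_all add: pdeg_zero pdeg_var)
  qed
  moreover have "R_invariant n i (\<lambda>X. f (Z X))" if i: "i \<in> {1..<m}" for i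
    unfolding R_invariant_def
  proof (intro allI impI)
    fix X assume d: "Rdefined n i X"
    have rows: "row (Z X) i = row X i" "row (Z X) (Suc i) = row X (Suc i)"
      using i by (auto simp: row_def Z_def)
    have "Rdefined n i (Z X)" using d rows by (simp add: Rdefined_def)
    moreover have "Rop n i (Z X) = Z (Rop n i X)"
    proof (rule ext, clarify)
      fix k r
      have "Z Y (l, r) = (if l = Suc m then 0 else Y (l, r))" for Y l by (simp add: Z_def)
      then show "Rop n i (Z X) (k, r) = Z (Rop n i X) (k, r)"
        using i rows by (simp add: Rop_def)
    qed
    ultimately show "f (Z (Rop n i X)) = f (Z X)"
      using 0(4) i ZJ[of X] by metis
  qed
  ultimately obtain P where P: "P \<in> pdeg ({1..m} \<times> {1..n}) fst d" and fP: "\<And>X. f (Z X) = P (emap m n X)"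
    using IH by blast
  have "f X = P (emap (Suc m) n X)" if X: "X \<in> zs ({Suc m} \<times> J)" for X
  proof -
    have x0: "X (Suc m, j) = 0" if "j \<in> {1..n}" for j using X that J by (simp add: zs_def)
    have "f X = f (Z X)"
    proof (rule pfun_cong[OF pdeg_imp_pfun[OF 0(3)]])
      fix v assume "v \<in> {1..Suc m} \<times> {1..n}"
      then obtain k r where "v = (k, r)" "r \<in> {1..n}" by blast
      then show "X v = Z X v" using x0 by (simp add: Z_def)
    qed
    then show ?thesis using fP emap_zero_row[OF n1, of X m] x0 by simp
  qed
  moreover have "P \<in> pdeg ({1..Suc m} \<times> {1..n}) fst d" by (rule pdeg_mono[OF P]) auto
  ultimately show ?case by blast
next
  case (Suc c)
  let ?V = "{1..Suc m} \<times> {1..n}"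
  let ?C = "{Suc m} \<times> J"
  have mM: "m \<in> {1..Suc m}" "Suc m \<in> {1..Suc m}" using m1 by auto
  have "{1..n} - J \<noteq> {}" using Suc.hyps(2) by (metis card.empty nat.distinct(1))
  then obtain j where j: "j \<in> {1..n}" "j \<notin> J" by blast
  have "{1..n} - J = insert j ({1..n} - insert j J)" using j by auto
  then have c: "c = card ({1..n} - insert j J)"
    using Suc.hyps(2) by (metis (no_types, lifting) DiffE card_insert_disjoint
        finite_Diff finite_atLeastAtMost insertI1 nat.inject)
  have jJ: "insert j J \<subseteq> {1..n}" using j Suc.prems(1) by simp
  have ins: "insert (Suc m, j) ?C = {Suc m} \<times> insert j J" by auto
  have sub: "X \<in> zs ?C" if "X \<in> zs (insert v ?C)" for X v using that by (auto simp: zs_def)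
  have RopZ: "Rop n i X \<in> zs ?C" if "X \<in> zs ?C" "Suc i \<le> m" for i X
    using that by (auto simp: zs_def Rop_def)
  show ?case using Suc.prems(2-4)
  proof (induction "nat (d + 1)" arbitrary: d f rule: less_induct)
    case less
    show ?case
    proof (cases "d < 0")
      case True
      then have "f X = 0" for X using pdeg_neg[OF less.prems(1)] by auto
      then show ?thesis by (intro bexI[of _ "\<lambda>_. 0"]) (auto intro: pdeg_zero)
    next
      case False
      obtain Q where Q: "Q \<in> pfun ?V" and fQ: "\<And>X. X \<in> zs ?C \<Longrightarrow> f X = Q (sym2 n m X)"
        using less.prems(3) by blast
      have inv: "f (Rop n i X) = f X" if "i \<in> {1..<m}" "X \<in> zs ?C" "Rdefined n i X" for i X
        using less.prems(2) that by blast
      have "\<exists>P\<in>pdeg ?V fst d. \<forall>X\<in>zs ({Suc m} \<times> insert j J). f X = P (emap (Suc m) n X)"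
      proof (rule Suc.hyps(1)[OF c jJ less.prems(1)])
        show "\<forall>i\<in>{1..<m}. \<forall>X\<in>zs ({Suc m} \<times> insert j J). Rdefined n i X \<longrightarrow> f (Rop n i X) = f X"
          using inv sub unfolding ins[symmetric] by blast
        show "\<exists>Q\<in>pfun ?V. \<forall>X\<in>zs ({Suc m} \<times> insert j J). f X = Q (sym2 n m X)"
          using Q fQ sub unfolding ins[symmetric] by blast
      qed
      then obtain P0 where P0: "P0 \<in> pdeg ?V fst d"
        and fP0: "\<And>X. X \<in> zs (insert (Suc m, j) ?C) \<Longrightarrow> f X = P0 (emap (Suc m) n X)"
        unfolding ins by blast
      have P0e: "(\<lambda>X. P0 (emap (Suc m) n X)) \<in> pdeg ?V (\<lambda>_. 1) d"
        by (rule emap_pdeg[OF n1 P0])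
      have P0inv: "P0 (emap (Suc m) n (Rop n i X)) = P0 (emap (Suc m) n X)"
        if "i \<in> {1..m}" "Rdefined n i X" for i X
        using emap_Rop[OF n1, of i "Suc m" X] that by simp
      \<comment> \<open>The subtracted term is invariant under R_m, hence also a polynomial in the
        invariants of the last two rows; so the property required of \<open>f\<close> passes to
        \<open>g\<close>.\<close>
      then have "R_invariant n m (\<lambda>X. P0 (emap (Suc m) n X))"
        using m1 by (simp add: R_invariant_def)
      then obtain Q0 where Q0: "Q0 \<in> pdeg ?V (w2 m) d"
        and P0Q0: "\<And>X. P0 (emap (Suc m) n X) = Q0 (sym2 n m X)"
        using R_invariant_imp_sym2[OF mM n1 P0e] by blast
      define g where "g = (\<lambda>X. f X - P0 (emap (Suc m) n X))"
      have g: "g \<in> pdeg ?V (\<lambda>_. 1) d" unfolding g_def by (intro pdeg_diff less.prems P0e)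
      have ginv: "g (Rop n i X) = g X" if "i \<in> {1..<m}" "X \<in> zs ?C" "Rdefined n i X" for i X
        using inv[OF that] P0inv[of i X] that by (simp add: g_def)
      have gj: "g X = 0" if "X \<in> zs (insert (Suc m, j) ?C)" for X
        using fP0[OF that] by (simp add: g_def)
      define Q2 where "Q2 = (\<lambda>Y. Q Y - Q0 Y)"
      have Q2: "Q2 \<in> pfun ?V" unfolding Q2_def by (intro pfun_diff Q pdeg_imp_pfun[OF Q0])
      have gQ2: "g X = Q2 (sym2 n m X)" if "X \<in> zs ?C" for X
        using fQ[OF that] P0Q0 by (simp add: g_def Q2_def)
      have Q2j: "Q2 Y = 0" if Y: "Y \<in> zs (insert (Suc m, j) ?C)" for Y
      proof (rule sym2_dominant[OF mM n1 jJ _ Q2, where B="{}"])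
        show "Y \<in> zs ({Suc m} \<times> insert j J \<union> {})" using Y unfolding ins by simp
        show "Q2 (sym2 n m X) = 0" if "X \<in> zs ({Suc m} \<times> insert j J \<union> {})" for X
          using gj gQ2 sub that unfolding ins by simp
      qed simp
      obtain e2 where e2: "Q2 \<in> pdeg ?V (\<lambda>_. 1) e2" using pfun_imp_pdeg[OF Q2] by blast
      obtain Q1 where Q1: "Q1 \<in> pfun ?V"
        and Q21: "\<And>Y. Y \<in> zs ?C \<Longrightarrow> Q2 Y = Y (Suc m, j) * Q1 Y"
        using pdeg_divide_var[OF e2 Q2j] pdeg_imp_pfun by blast
      have sZ: "sym2 n m X \<in> zs ?C" if "X \<in> zs ?C" for X
        using sym2_in_zs[of X m J "{}" n] that by simp
      \<comment> \<open>The variable at \<open>(Suc m, j)\<close> becomes the product of the last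
        two entries of column j, so \<open>g\<close> also vanishes where the entry in row m
        does.\<close>
      have gQ1: "g X = X (m, j) * X (Suc m, j) * Q1 (sym2 n m X)" if X: "X \<in> zs ?C" for X
        using gQ2[OF X] Q21[OF sZ[OF X]] by (simp add: sym2_def)
      \<comment> \<open>Downward induction from row m: R_k moves a zero from row k to row k + 1 of
        column j, where \<open>g\<close> is already known to vanish.\<close>
      have van: "g X = 0" if k: "1 \<le> k" "k \<le> m" and X: "X \<in> zs (insert (k, j) ?C)" for k X
        using k(2,1) X
      proof (induction k arbitrary: X rule: inc_induct)
        case base
        then show ?case using gQ1[OF sub[OF base(2)]] by (simp add: zs_def)
      next
        case (step k)
        have k: "k \<in> {1..<m}" "k \<in> {1..Suc m}" "Suc k \<in> {1..Suc m}" using step by auto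
        let ?B = "insert (k, j) ?C"
        let ?b = "off (?B \<union> {k} \<times> UNIV)"
        let ?q = "\<lambda>X. \<Prod>r\<in>{1..<Suc n}. kappa n (row X k) (row X (Suc k)) r"
        show ?case
        proof (rule pfun_eq_0_dense[OF pdeg_imp_pfun[OF g], where g="?q" and W=UNIV and B="?B" and b="?b"])
          show "?q \<in> pfun UNIV" by (intro pfun_prod kappa_pfun)
          show "?b \<in> zs ?B" by (auto simp: zs_def off_def)
          have "row ?b k = (\<lambda>_. 0)" "row ?b (Suc k) = (\<lambda>_. 1)"
            using k(1) by (auto simp: row_def off_def)
          then show "?q ?b \<noteq> 0" by (simp add: kappa_const_0_1[OF n1] del: prod.op_ivl_Suc)
          show "X \<in> zs ?B" by (rule step.prems(2))
          fix X assume X: "X \<in> zs ?B"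
          show "g X * ?q X = 0"
          proof (cases "?q X = 0")
            case False
            then have d: "Rdefined n k X"
              using prod_kappa_nonzero_iff[OF k(2,3) n1, of X] by blast
            have "Rop n k X \<in> zs (insert (Suc k, j) ?C)"
              using RopZ[OF sub[OF X], of k] k X by (auto simp: zs_def Rop_def Rnew_x_def row_def)
            then have "g (Rop n k X) = 0" using step.IH k by simp
            then show ?thesis using ginv[OF k(1) sub[OF X] d] by simp
          qed simp
        qed
      qed
      let ?A = "{1..Suc m} \<times> {j}"
      have "\<exists>h\<in>pdeg ?V (\<lambda>_. 1) (d - int (\<Sum>v\<in>?A. 1)). \<forall>X\<in>zs ?C. g X = (\<Prod>v\<in>?A. X v) * h X"
      proof (rule pdeg_divide_vars[OF _ g])
        fix v X assume "v \<in> ?A" and X: "X \<in> zs (insert v ?C)"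
        then obtain k where "v = (k, j)" "1 \<le> k" "k \<le> Suc m" by auto
        then show "g X = 0" using X gj van[of k X] by (cases "k = Suc m") auto
      qed (use j in auto)
      then obtain h where h: "h \<in> pdeg ?V (\<lambda>_. 1) (d - int (Suc m))"
        and gh: "\<And>X. X \<in> zs ?C \<Longrightarrow> g X = (\<Prod>v\<in>?A. X v) * h X"
        by auto
      have le: "loop_e (Suc m) n (Suc m) j X = (\<Prod>v\<in>?A. X v)" for X
      proof -
        have "?A = (\<lambda>k. (k, j)) ` {1..Suc m}" by auto
        then have "(\<Prod>v\<in>?A. X v) = (\<Prod>k\<in>{1..Suc m}. X (k, j))"
          by (simp only: prod.reindex[OF inj_onI] prod.inject o_def) (simp add: prod.reindex inj_on_def)
        then show ?thesis using loop_e_top[OF j(1), of "Suc m" X] by simp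
      qed
      have offA: "(\<Prod>v\<in>A. off ?C v) \<noteq> 0" if "A \<inter> ?C = {}" "finite A" for A
        using that by (auto simp: off_def)
      \<comment> \<open>The column product is the top loop function, hence invariant, and cancels on
        a dense set.\<close>
      have hinv: "h (Rop n i X) = h X" if i: "i \<in> {1..<m}" and X: "X \<in> zs ?C" "Rdefined n i X" for i X
      proof (rule R_eq_dense[OF _ _ n1 pdeg_imp_pfun[OF h], where g="\<lambda>X. \<Prod>v\<in>?A. X v" and b="off ?C" and B="?C"])
        fix X assume X: "X \<in> zs ?C" and d: "Rdefined n i X" and nz: "(\<Prod>v\<in>?A. X v) \<noteq> 0"
        have "(\<Prod>v\<in>?A. Rop n i X v) = (\<Prod>v\<in>?A. X v)"
          using loop_e_Rop[OF n1 _ _ d, of "Suc m" "Suc m" j] i unfolding le by simp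
        then have "(\<Prod>v\<in>?A. X v) * h (Rop n i X) = (\<Prod>v\<in>?A. X v) * h X"
          using ginv[OF i X d] gh[OF X] gh[OF RopZ[OF X]] i by simp
        then show "h (Rop n i X) = h X" using nz by simp
      next
        show "(\<Prod>v\<in>?A. off ?C v) \<noteq> 0" using j by (intro offA) auto
      qed (use i X off_in_zs in \<open>auto intro!: pfun_intros\<close>)
      let ?A' = "{1..<m} \<times> {j}"
      have AA': "(\<Prod>v\<in>?A. X v) = X (m, j) * X (Suc m, j) * (\<Prod>v\<in>?A'. X v)" for X :: mat
      proof -
        have "?A = insert (m, j) (insert (Suc m, j) ?A')" using m1 by auto
        then show ?thesis by (simp add: mult.assoc)
      qed
      have Q1S: "(\<lambda>X. Q1 (sym2 n m X)) \<in> pfun ?V"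
        using sym2_pdeg[OF mM n1] pdeg_imp_pfun by (intro pfun_comp[OF Q1]) blast
      have hQ1: "(\<Prod>v\<in>?A'. X v) * h X = Q1 (sym2 n m X)" if X: "X \<in> zs ?C" for X
      proof -
        have "(\<Prod>v\<in>?A'. X v) * h X - Q1 (sym2 n m X) = 0"
        proof (rule pfun_eq_0_dense[where f="\<lambda>X. (\<Prod>v\<in>?A'. X v) * h X - Q1 (sym2 n m X)"
              and V="?V" and g="\<lambda>X. X (m, j) * X (Suc m, j)" and W=UNIV and B="?C" and b="off ?C"])
          show "(\<lambda>X. (\<Prod>v\<in>?A'. X v) * h X - Q1 (sym2 n m X)) \<in> pfun ?V"
            using j by (intro pfun_diff[OF _ Q1S] pmult[OF _ pdeg_imp_pfun[OF h]] pfun_prod pvar) auto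
          fix X assume X: "X \<in> zs ?C"
          show "((\<Prod>v\<in>?A'. X v) * h X - Q1 (sym2 n m X)) * (X (m, j) * X (Suc m, j)) = 0"
            using gh[OF X] gQ1[OF X] unfolding AA' by (auto simp: algebra_simps)
        next
          show "off ?C (m, j) * off ?C (Suc m, j) \<noteq> 0" using j by (auto simp: off_def)
        qed (use X off_in_zs in \<open>auto intro!: pfun_intros\<close>)
        then show ?thesis by simp
      qed
      obtain e where e: "Q1 \<in> pdeg ?V (\<lambda>_. 1) e" using pfun_imp_pdeg[OF Q1] by blast
      \<comment> \<open>For \<open>h\<close> itself to be a polynomial in the two-row invariants,
        the other entries of column j must be divided out of \<open>Q1\<close>. They are fixed by
        \<open>sym2\<close>, and \<open>sym2_dominant\<close> on the subspace where one of them
        vanishes shows that \<open>Q1\<close> is zero there.\<close>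
      have "\<exists>q\<in>pdeg ?V (\<lambda>_. 1) (e - int (\<Sum>v\<in>?A'. 1)). \<forall>Y\<in>zs ?C. Q1 Y = (\<Prod>v\<in>?A'. Y v) * q Y"
      proof (rule pdeg_divide_vars[OF _ e])
        fix v Y assume v: "v \<in> ?A'" and Y: "Y \<in> zs (insert v ?C)"
        show "Q1 Y = 0"
        proof (rule sym2_dominant[OF mM n1 Suc.prems(1) _ Q1, where B="{v}"])
          fix X assume X: "X \<in> zs (?C \<union> {v})"
          then have "X v = 0" "X \<in> zs ?C" by (auto simp: zs_def)
          moreover have "(\<Prod>v\<in>?A'. X v) = 0" using v \<open>X v = 0\<close> by (intro prod_zero) auto
          ultimately show "Q1 (sym2 n m X) = 0" using hQ1[of X] by (metis mult_zero_left)
        qed (use v Y in auto)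
      qed (use j in auto)
      then obtain q where q: "q \<in> pfun ?V" and Q1q: "\<And>Y. Y \<in> zs ?C \<Longrightarrow> Q1 Y = (\<Prod>v\<in>?A'. Y v) * q Y"
        using pdeg_imp_pfun by blast
      have qS: "(\<lambda>X. q (sym2 n m X)) \<in> pfun ?V"
        using sym2_pdeg[OF mM n1] pdeg_imp_pfun by (intro pfun_comp[OF q]) blast
      have hq: "h X = q (sym2 n m X)" if X: "X \<in> zs ?C" for X
      proof -
        have "h X - q (sym2 n m X) = 0"
        proof (rule pfun_eq_0_dense[where f="\<lambda>X. h X - q (sym2 n m X)"
              and V="?V" and g="\<lambda>X. \<Prod>v\<in>?A'. X v" and W=UNIV and B="?C" and b="off ?C"])
          show "(\<lambda>X. h X - q (sym2 n m X)) \<in> pfun ?V"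
            by (intro pfun_diff[OF _ qS] pdeg_imp_pfun[OF h])
          fix X assume X: "X \<in> zs ?C"
          have "(\<Prod>v\<in>?A'. sym2 n m X v) = (\<Prod>v\<in>?A'. X v)"
            by (rule prod.cong) (auto simp: sym2_def)
          then show "(h X - q (sym2 n m X)) * (\<Prod>v\<in>?A'. X v) = 0"
            using hQ1[OF X] Q1q[OF sZ[OF X]] by (simp add: algebra_simps)
        next
          show "(\<Prod>v\<in>?A'. off ?C v) \<noteq> 0" using j by (intro offA) auto
        qed (use X off_in_zs in \<open>auto intro!: pfun_intros\<close>)
        then show ?thesis by simp
      qed
      have "\<exists>P\<in>pdeg ?V fst (d - int (Suc m)). \<forall>X\<in>zs ?C. h X = P (emap (Suc m) n X)"
      proof (rule less.hyps[OF _ h])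
        show "nat (d - int (Suc m) + 1) < nat (d + 1)" using False by simp
      qed (use hinv hq q in blast)+
      then obtain P1 where P1: "P1 \<in> pdeg ?V fst (d - int (Suc m))"
        and hP1: "\<And>X. X \<in> zs ?C \<Longrightarrow> h X = P1 (emap (Suc m) n X)" by blast
      define P where "P = (\<lambda>Y. P0 Y + Y (Suc m, j) * P1 Y)"
      have "(\<lambda>Y::mat. Y (Suc m, j)) \<in> pdeg ?V fst (int (Suc m))"
        using j by (intro pdeg_var) auto
      then have "P \<in> pdeg ?V fst d"
        unfolding P_def by (intro pdeg_add[OF P0] pdeg_mult[OF _ P1]) auto
      moreover have "f X = P (emap (Suc m) n X)" if X: "X \<in> zs ?C" for X
      proof -
        have "emap (Suc m) n X (Suc m, j) = (\<Prod>v\<in>?A. X v)" using le by (simp add: emap_def)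
        then show ?thesis
          using gh[OF X] hP1[OF X] by (simp add: g_def P_def algebra_simps)
      qed
      ultimately show ?thesis by blast
    qed
  qed
qed

text \<open>For one row the functions e_1 are the entries themselves. Each further row is the case
  of empty \<open>J\<close> in \<open>R_invariant_imp_emap_step\<close>, with \<open>Q\<close> from
  the two-row result.\<close>

lemma R_invariant_imp_emap:
  assumes n1: "1 \<le> n" and m1: "1 \<le> m"
    and f: "f \<in> pdeg ({1..m} \<times> {1..n}) (\<lambda>_. 1) d" and inv: "\<And>i. i \<in> {1..<m} \<Longrightarrow> R_invariant n i f"
  shows "\<exists>P\<in>pdeg ({1..m} \<times> {1..n}) fst d. \<forall>X. f X = P (emap m n X)"
  using m1 f inv
proof (induction m arbitrary: f d rule: nat_induct_at_least)
  case base
  have e: "emap 1 n X (1, r) = X (1, r)" if "r \<in> {1..n}" for X r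
    using loop_e_top[OF that, of 1 X] by (simp add: emap_def)
  have "f X = f (emap 1 n X)" for X
  proof (rule pfun_cong[OF pdeg_imp_pfun[OF base(1)]])
    fix v assume "v \<in> {1..1::nat} \<times> {1..n}"
    then obtain r where "v = (1, r)" "r \<in> {1..n}" by auto
    then show "X v = emap 1 n X v" using e by simp
  qed
  moreover have "f \<in> pdeg ({1..1} \<times> {1..n}) fst d"
  proof (rule pdeg_comp[OF base(1)])
    fix v assume "v \<in> {1..1::nat} \<times> {1..n}"
    then show "(\<lambda>X. X v) \<in> pdeg ({1..1} \<times> {1..n}) fst (int 1)" by (intro pdeg_var) auto
  qed
  ultimately show ?case by blast
next
  case (Suc m)
  have mM: "m \<in> {1..Suc m}" "Suc m \<in> {1..Suc m}" using Suc.hyps by auto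
  obtain Q where "Q \<in> pdeg ({1..Suc m} \<times> {1..n}) (w2 m) d" "\<And>X. f X = Q (sym2 n m X)"
    using R_invariant_imp_sym2[OF mM n1 Suc.prems(1)] Suc.prems(2)[of m] Suc.hyps by auto
  then have "\<exists>Q\<in>pfun ({1..Suc m} \<times> {1..n}). \<forall>X\<in>zs ({Suc m} \<times> {}). f X = Q (sym2 n m X)"
    using pdeg_imp_pfun by blast
  moreover have "\<forall>i\<in>{1..<m}. \<forall>X\<in>zs ({Suc m} \<times> {}). Rdefined n i X \<longrightarrow> f (Rop n i X) = f X"
    using Suc.prems(2) by (auto simp: R_invariant_def)
  ultimately have "\<exists>P\<in>pdeg ({1..Suc m} \<times> {1..n}) fst d. \<forall>X\<in>zs ({Suc m} \<times> {}). f X = P (emap (Suc m) n X)"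
    by (intro R_invariant_imp_emap_step[OF n1 Suc.hyps Suc.IH _ Suc.prems(1)]) auto
  then show ?case by (simp add: zs_def)
qed

theorem theorem6p6:
  fixes m n :: nat
  assumes "1 \<le> m" and "1 \<le> n"
  shows "{f \<in> pfun ({1..m} \<times> {1..n}). \<forall>i\<in>{1..m-1}. R_invariant n i f}
       = {(\<lambda>X. P (\<lambda>(k, r). loop_e m n k r X)) | P. P \<in> pfun ({1..m} \<times> {1..n})}"
proof (intro equalityI subsetI)
  fix f assume "f \<in> {f \<in> pfun ({1..m} \<times> {1..n}). \<forall>i\<in>{1..m-1}. R_invariant n i f}"
  then have f: "f \<in> pfun ({1..m} \<times> {1..n})" and inv: "\<And>i. i \<in> {1..<m} \<Longrightarrow> R_invariant n i f"
    by auto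
  obtain d where "f \<in> pdeg ({1..m} \<times> {1..n}) (\<lambda>_. 1) d" using pfun_imp_pdeg[OF f] by blast
  then obtain P where "P \<in> pdeg ({1..m} \<times> {1..n}) fst d" "\<And>X. f X = P (emap m n X)"
    using R_invariant_imp_emap[OF assms(2,1) _ inv] by blast
  then show "f \<in> {(\<lambda>X. P (\<lambda>(k, r). loop_e m n k r X)) | P. P \<in> pfun ({1..m} \<times> {1..n})}"
    using pdeg_imp_pfun unfolding emap_def by blast
next
  fix f assume "f \<in> {(\<lambda>X. P (\<lambda>(k, r). loop_e m n k r X)) | P. P \<in> pfun ({1..m} \<times> {1..n})}"
  then obtain P where P: "P \<in> pfun ({1..m} \<times> {1..n})" and f: "f = (\<lambda>X. P (emap m n X))"
    unfolding emap_def by blast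
  have "f \<in> pfun ({1..m} \<times> {1..n})"
    unfolding f using pfun_imp_pdeg[OF P, of fst] emap_pdeg[OF assms(2)] pdeg_imp_pfun by blast
  moreover have "R_invariant n i f" if "i \<in> {1..m-1}" for i
    using that emap_Rop[OF assms(2), of i m] by (auto simp: R_invariant_def f)
  ultimately show "f \<in> {f \<in> pfun ({1..m} \<times> {1..n}). \<forall>i\<in>{1..m-1}. R_invariant n i f}" by blast
qed

end
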